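(* Each of the following principles on its own implies Rosolini choice (i.e. for all $P,Q:\mathcal U$, $\operatorname{isRosolini}(P)\to(P\to\lVert\operatorname{rosoliniStructure}(Q)\rVert)\to\lVert P\to\operatorname{rosoliniStructure}(Q)\rVert$): (1) countable choice; (2) for every type $A$ and every $\alpha:\mathbb N\to2$, $\big(\prod_{n}\lVert(\alpha_n=1)\to A\rVert\big)\to\lVert\prod_n((\alpha_n=1)\to A)\rVert$; (3) untruncated LPO: $\prod_{\alpha:\mathbb N\to 2}\big(\langle\alpha\rangle+(\alpha=\lambda n.0)\big)$; (4) untruncated WLPO: $\prod_{\alpha:\mathbb N\to2}\big(\langle\alpha\rangle+\neg\langle\alpha\rangle\big)$; (5) truncated WLPO: $\prod_{\alpha:\mathbb N\to2}\lVert\langle\alpha\rangle+\neg\langle\alpha\rangle\rVert$; (6) propositional choice: for all $P,A:\mathcal U$ with $A$ a set and $P$ a proposition, $(P\to\lVert A\rVert)\to\lVert P\to A\rVert$.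
   Context: Type theory: Martin-Löf type theory with universe $\mathcal U$, function extensionality, proposition extensionality and propositional truncations $\lVert X\rVert$. For $\alpha:\mathbb N\to 2$ let $\langle\alpha\rangle:=\sum_{n:\mathbb N}(\alpha_n=1)$; $\mathbb N_\infty:=\sum_{\alpha:\mathbb N\to2}\operatorname{isProp}(\langle\alpha\rangle)$, and for $u:\mathbb N_\infty$, $\langle u\rangle$ is $\langle\alpha\rangle$ of its underlying sequence. $\operatorname{rosoliniStructure}(P):=\sum_{u:\mathbb N_\infty}(P=\langle u\rangle)$ and $\operatorname{isRosolini}(P):=\lVert\operatorname{rosoliniStructure}(P)\rVert$. Countable choice: for every family $Y:\mathbb N\to\mathcal U$, $\big(\prod_{n}\lVert Y(n)\rVert\big)\to\lVert\prod_n Y(n)\rVert$. A set is a type whose identity types are propositions. *)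

theory Defs
  imports Main
begin

text \<open>
  The claim is about derivability in intensional Martin-Loef type theory, so the type theory is
  given as a deep embedding (de Bruijn syntax with inductively defined judgements). In a shallow
  rendering the binders would range over arbitrary functions of the classical meta-logic, and all
  the choice and omniscience principles below would hold outright.

  The theory has a cumulative Russell-style hierarchy of universes, dependent products and sums
  (both with eta), binary sums, the types 0, 1, 2 and N, identity types, propositional
  truncations, function extensionality and proposition extensionality. A hierarchy is needed since
  the identity type \<open>P = Q\<close> of two elements of a universe lives in the next universe.
\<close>

section \<open>Syntax\<close>

text \<open>
  Variables bound in the last-listed position have index 0. Binding structure: the second argument
  of \<open>Pi\<close>, \<open>Lam\<close> and \<open>Sg\<close> binds one variable; the motives (first
  arguments) of \<open>Case\<close>, \<open>Abort\<close>, \<open>UnitInd\<close>,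
  \<open>TwoInd\<close> and \<open>NatInd\<close>, and both branches of \<open>Case\<close>, bind one
  variable; the step of \<open>NatInd\<close> binds two (the predecessor has index 1, the recursive
  value index 0); the motive of \<open>J\<close> (its third argument) binds two (the endpoint has index
  1, the path index 0).
\<close>

datatype tm =
    Var nat
  | Univ nat
  | Pi tm tm | Lam tm tm | App tm tm
  | Sg tm tm | Pr tm tm | Fst tm | Snd tm
  | Plus tm tm | InjL tm | InjR tm | Case tm tm tm tm
  | Empty | Abort tm tm
  | Unit | Star | UnitInd tm tm tm
  | Two | Zero2 | One2 | TwoInd tm tm tm tm
  | Nat | Zero | Succ tm | NatInd tm tm tm tm
  | Idt tm tm tm | Refl tm | J tm tm tm tm tm tm
  | Trunc tm | Inc tm | Squash tm tm | TruncRec tm tm tm tm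
  | Funext tm tm tm
  | Propext tm tm tm tm tm tm

definition upren :: "(nat \<Rightarrow> nat) \<Rightarrow> nat \<Rightarrow> nat" where
  "upren r = case_nat 0 (\<lambda>k. Suc (r k))"

primrec ren :: "(nat \<Rightarrow> nat) \<Rightarrow> tm \<Rightarrow> tm" where
  "ren r (Var k) = Var (r k)"
| "ren r (Univ l) = Univ l"
| "ren r (Pi A B) = Pi (ren r A) (ren (upren r) B)"
| "ren r (Lam A b) = Lam (ren r A) (ren (upren r) b)"
| "ren r (App f a) = App (ren r f) (ren r a)"
| "ren r (Sg A B) = Sg (ren r A) (ren (upren r) B)"
| "ren r (Pr a b) = Pr (ren r a) (ren r b)"
| "ren r (Fst p) = Fst (ren r p)"
| "ren r (Snd p) = Snd (ren r p)"
| "ren r (Plus A B) = Plus (ren r A) (ren r B)"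
| "ren r (InjL a) = InjL (ren r a)"
| "ren r (InjR b) = InjR (ren r b)"
| "ren r (Case C c d s) = Case (ren (upren r) C) (ren (upren r) c) (ren (upren r) d) (ren r s)"
| "ren r Empty = Empty"
| "ren r (Abort C s) = Abort (ren (upren r) C) (ren r s)"
| "ren r Unit = Unit"
| "ren r Star = Star"
| "ren r (UnitInd C c s) = UnitInd (ren (upren r) C) (ren r c) (ren r s)"
| "ren r Two = Two"
| "ren r Zero2 = Zero2"
| "ren r One2 = One2"
| "ren r (TwoInd C c d s) = TwoInd (ren (upren r) C) (ren r c) (ren r d) (ren r s)"
| "ren r Nat = Nat"
| "ren r Zero = Zero"
| "ren r (Succ n) = Succ (ren r n)"
| "ren r (NatInd C c d n) =
     NatInd (ren (upren r) C) (ren r c) (ren (upren (upren r)) d) (ren r n)"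
| "ren r (Idt A a b) = Idt (ren r A) (ren r a) (ren r b)"
| "ren r (Refl a) = Refl (ren r a)"
| "ren r (J A a C c b p) =
     J (ren r A) (ren r a) (ren (upren (upren r)) C) (ren r c) (ren r b) (ren r p)"
| "ren r (Trunc A) = Trunc (ren r A)"
| "ren r (Inc a) = Inc (ren r a)"
| "ren r (Squash a b) = Squash (ren r a) (ren r b)"
| "ren r (TruncRec B h f x) = TruncRec (ren r B) (ren r h) (ren r f) (ren r x)"
| "ren r (Funext f g h) = Funext (ren r f) (ren r g) (ren r h)"
| "ren r (Propext P Q p q f g) =
     Propext (ren r P) (ren r Q) (ren r p) (ren r q) (ren r f) (ren r g)"

abbreviation wk :: "tm \<Rightarrow> tm" where
  "wk \<equiv> ren Suc"

definition scons :: "tm \<Rightarrow> (nat \<Rightarrow> tm) \<Rightarrow> nat \<Rightarrow> tm" where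
  "scons a s = case_nat a s"

definition up :: "(nat \<Rightarrow> tm) \<Rightarrow> nat \<Rightarrow> tm" where
  "up s = scons (Var 0) (\<lambda>k. wk (s k))"

primrec subst :: "(nat \<Rightarrow> tm) \<Rightarrow> tm \<Rightarrow> tm" where
  "subst s (Var k) = s k"
| "subst s (Univ l) = Univ l"
| "subst s (Pi A B) = Pi (subst s A) (subst (up s) B)"
| "subst s (Lam A b) = Lam (subst s A) (subst (up s) b)"
| "subst s (App f a) = App (subst s f) (subst s a)"
| "subst s (Sg A B) = Sg (subst s A) (subst (up s) B)"
| "subst s (Pr a b) = Pr (subst s a) (subst s b)"
| "subst s (Fst p) = Fst (subst s p)"
| "subst s (Snd p) = Snd (subst s p)"
| "subst s (Plus A B) = Plus (subst s A) (subst s B)"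
| "subst s (InjL a) = InjL (subst s a)"
| "subst s (InjR b) = InjR (subst s b)"
| "subst s (Case C c d t) =
     Case (subst (up s) C) (subst (up s) c) (subst (up s) d) (subst s t)"
| "subst s Empty = Empty"
| "subst s (Abort C t) = Abort (subst (up s) C) (subst s t)"
| "subst s Unit = Unit"
| "subst s Star = Star"
| "subst s (UnitInd C c t) = UnitInd (subst (up s) C) (subst s c) (subst s t)"
| "subst s Two = Two"
| "subst s Zero2 = Zero2"
| "subst s One2 = One2"
| "subst s (TwoInd C c d t) = TwoInd (subst (up s) C) (subst s c) (subst s d) (subst s t)"
| "subst s Nat = Nat"
| "subst s Zero = Zero"
| "subst s (Succ n) = Succ (subst s n)"
| "subst s (NatInd C c d n) =
     NatInd (subst (up s) C) (subst s c) (subst (up (up s)) d) (subst s n)"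
| "subst s (Idt A a b) = Idt (subst s A) (subst s a) (subst s b)"
| "subst s (Refl a) = Refl (subst s a)"
| "subst s (J A a C c b p) =
     J (subst s A) (subst s a) (subst (up (up s)) C) (subst s c) (subst s b) (subst s p)"
| "subst s (Trunc A) = Trunc (subst s A)"
| "subst s (Inc a) = Inc (subst s a)"
| "subst s (Squash a b) = Squash (subst s a) (subst s b)"
| "subst s (TruncRec B h f x) = TruncRec (subst s B) (subst s h) (subst s f) (subst s x)"
| "subst s (Funext f g h) = Funext (subst s f) (subst s g) (subst s h)"
| "subst s (Propext P Q p q f g) =
     Propext (subst s P) (subst s Q) (subst s p) (subst s q) (subst s f) (subst s g)"

definition inst :: "tm \<Rightarrow> tm \<Rightarrow> tm" where
  "inst t a = subst (scons a Var) t"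

text \<open>\<open>inst2 t a b\<close> puts \<open>a\<close> for index 1 and \<open>b\<close> for index 0.\<close>

definition inst2 :: "tm \<Rightarrow> tm \<Rightarrow> tm \<Rightarrow> tm" where
  "inst2 t a b = subst (scons b (scons a Var)) t"

definition arr :: "tm \<Rightarrow> tm \<Rightarrow> tm"  (infixr "\<rightarrow>\<^sub>t" 60) where
  "A \<rightarrow>\<^sub>t B = Pi A (wk B)"

definition isProp :: "tm \<Rightarrow> tm" where
  "isProp A = Pi A (Pi (wk A) (Idt (wk (wk A)) (Var 1) (Var 0)))"


section \<open>Judgements\<close>

text \<open>
  Contexts are lists of types, innermost first. A type is a term of type \<open>Univ l\<close> for some
  \<open>l\<close>. The rules \<open>ty_subst\<close> and \<open>eq_subst\<close> are the usual structural
  rules of weakening and substitution, stated once for simultaneous substitutions. The eliminator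
  \<open>J\<close> is based path induction. No computation
  rule is imposed on truncation, and the two extensionality principles are stated in their weak
  form (pointwise equal functions are equal, logically equivalent propositions are equal).
\<close>

inductive
  ctx :: "tm list \<Rightarrow> bool"  ("\<turnstile> _" [40] 40) and
  has_ty :: "tm list \<Rightarrow> tm \<Rightarrow> tm \<Rightarrow> bool"  ("_ \<turnstile> _ \<^bold>: _" [40, 40, 40] 40) and
  eq_tm :: "tm list \<Rightarrow> tm \<Rightarrow> tm \<Rightarrow> tm \<Rightarrow> bool"
    ("_ \<turnstile> _ \<^bold>\<equiv> _ \<^bold>: _" [40, 40, 40, 40] 40)
where
  ctx_nil: "\<turnstile> []"
| ctx_cons: "\<Gamma> \<turnstile> A \<^bold>: Univ l \<Longrightarrow> \<turnstile> A # \<Gamma>"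

| ty_var: "\<lbrakk>\<turnstile> \<Gamma>; k < length \<Gamma>\<rbrakk> \<Longrightarrow> \<Gamma> \<turnstile> Var k \<^bold>: ren (\<lambda>m. m + Suc k) (\<Gamma> ! k)"
| ty_conv: "\<lbrakk>\<Gamma> \<turnstile> a \<^bold>: A; \<Gamma> \<turnstile> A \<^bold>\<equiv> B \<^bold>: Univ l\<rbrakk> \<Longrightarrow> \<Gamma> \<turnstile> a \<^bold>: B"
| ty_subst: "\<lbrakk>\<Gamma> \<turnstile> a \<^bold>: A; \<turnstile> \<Delta>;
    \<And>k. k < length \<Gamma> \<Longrightarrow> \<Delta> \<turnstile> s k \<^bold>: subst s (ren (\<lambda>m. m + Suc k) (\<Gamma> ! k))\<rbrakk>
    \<Longrightarrow> \<Delta> \<turnstile> subst s a \<^bold>: subst s A"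
| eq_refl: "\<Gamma> \<turnstile> a \<^bold>: A \<Longrightarrow> \<Gamma> \<turnstile> a \<^bold>\<equiv> a \<^bold>: A"
| eq_sym: "\<Gamma> \<turnstile> a \<^bold>\<equiv> b \<^bold>: A \<Longrightarrow> \<Gamma> \<turnstile> b \<^bold>\<equiv> a \<^bold>: A"
| eq_trans: "\<lbrakk>\<Gamma> \<turnstile> a \<^bold>\<equiv> b \<^bold>: A; \<Gamma> \<turnstile> b \<^bold>\<equiv> c \<^bold>: A\<rbrakk> \<Longrightarrow> \<Gamma> \<turnstile> a \<^bold>\<equiv> c \<^bold>: A"
| eq_conv: "\<lbrakk>\<Gamma> \<turnstile> a \<^bold>\<equiv> b \<^bold>: A; \<Gamma> \<turnstile> A \<^bold>\<equiv> B \<^bold>: Univ l\<rbrakk> \<Longrightarrow> \<Gamma> \<turnstile> a \<^bold>\<equiv> b \<^bold>: B"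
| eq_subst: "\<lbrakk>\<Gamma> \<turnstile> a \<^bold>\<equiv> b \<^bold>: A; \<turnstile> \<Delta>;
    \<And>k. k < length \<Gamma> \<Longrightarrow> \<Delta> \<turnstile> s k \<^bold>: subst s (ren (\<lambda>m. m + Suc k) (\<Gamma> ! k))\<rbrakk>
    \<Longrightarrow> \<Delta> \<turnstile> subst s a \<^bold>\<equiv> subst s b \<^bold>: subst s A"

| ty_univ: "\<turnstile> \<Gamma> \<Longrightarrow> \<Gamma> \<turnstile> Univ l \<^bold>: Univ (Suc l)"
| ty_cumul: "\<Gamma> \<turnstile> A \<^bold>: Univ l \<Longrightarrow> \<Gamma> \<turnstile> A \<^bold>: Univ (Suc l)"
| eq_cumul: "\<Gamma> \<turnstile> A \<^bold>\<equiv> B \<^bold>: Univ l \<Longrightarrow> \<Gamma> \<turnstile> A \<^bold>\<equiv> B \<^bold>: Univ (Suc l)"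

| ty_Pi: "\<lbrakk>\<Gamma> \<turnstile> A \<^bold>: Univ l; A # \<Gamma> \<turnstile> B \<^bold>: Univ l\<rbrakk> \<Longrightarrow> \<Gamma> \<turnstile> Pi A B \<^bold>: Univ l"
| ty_Lam: "A # \<Gamma> \<turnstile> b \<^bold>: B \<Longrightarrow> \<Gamma> \<turnstile> Lam A b \<^bold>: Pi A B"
| ty_App: "\<lbrakk>\<Gamma> \<turnstile> f \<^bold>: Pi A B; \<Gamma> \<turnstile> a \<^bold>: A\<rbrakk> \<Longrightarrow> \<Gamma> \<turnstile> App f a \<^bold>: inst B a"
| eq_Pi: "\<lbrakk>\<Gamma> \<turnstile> A \<^bold>\<equiv> A' \<^bold>: Univ l; A # \<Gamma> \<turnstile> B \<^bold>\<equiv> B' \<^bold>: Univ l\<rbrakk>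
    \<Longrightarrow> \<Gamma> \<turnstile> Pi A B \<^bold>\<equiv> Pi A' B' \<^bold>: Univ l"
| eq_Lam: "\<lbrakk>\<Gamma> \<turnstile> A \<^bold>\<equiv> A' \<^bold>: Univ l; A # \<Gamma> \<turnstile> b \<^bold>\<equiv> b' \<^bold>: B\<rbrakk>
    \<Longrightarrow> \<Gamma> \<turnstile> Lam A b \<^bold>\<equiv> Lam A' b' \<^bold>: Pi A B"
| eq_App: "\<lbrakk>\<Gamma> \<turnstile> f \<^bold>\<equiv> f' \<^bold>: Pi A B; \<Gamma> \<turnstile> a \<^bold>\<equiv> a' \<^bold>: A\<rbrakk>
    \<Longrightarrow> \<Gamma> \<turnstile> App f a \<^bold>\<equiv> App f' a' \<^bold>: inst B a"
| Pi_beta: "\<lbrakk>A # \<Gamma> \<turnstile> b \<^bold>: B; \<Gamma> \<turnstile> a \<^bold>: A\<rbrakk>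
    \<Longrightarrow> \<Gamma> \<turnstile> App (Lam A b) a \<^bold>\<equiv> inst b a \<^bold>: inst B a"
| Pi_eta: "\<Gamma> \<turnstile> f \<^bold>: Pi A B \<Longrightarrow> \<Gamma> \<turnstile> Lam A (App (wk f) (Var 0)) \<^bold>\<equiv> f \<^bold>: Pi A B"

| ty_Sg: "\<lbrakk>\<Gamma> \<turnstile> A \<^bold>: Univ l; A # \<Gamma> \<turnstile> B \<^bold>: Univ l\<rbrakk> \<Longrightarrow> \<Gamma> \<turnstile> Sg A B \<^bold>: Univ l"
| ty_Pr: "\<lbrakk>A # \<Gamma> \<turnstile> B \<^bold>: Univ l; \<Gamma> \<turnstile> a \<^bold>: A; \<Gamma> \<turnstile> b \<^bold>: inst B a\<rbrakk> \<Longrightarrow> \<Gamma> \<turnstile> Pr a b \<^bold>: Sg A B"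
| ty_Fst: "\<Gamma> \<turnstile> p \<^bold>: Sg A B \<Longrightarrow> \<Gamma> \<turnstile> Fst p \<^bold>: A"
| ty_Snd: "\<Gamma> \<turnstile> p \<^bold>: Sg A B \<Longrightarrow> \<Gamma> \<turnstile> Snd p \<^bold>: inst B (Fst p)"
| eq_Sg: "\<lbrakk>\<Gamma> \<turnstile> A \<^bold>\<equiv> A' \<^bold>: Univ l; A # \<Gamma> \<turnstile> B \<^bold>\<equiv> B' \<^bold>: Univ l\<rbrakk>
    \<Longrightarrow> \<Gamma> \<turnstile> Sg A B \<^bold>\<equiv> Sg A' B' \<^bold>: Univ l"
| eq_Pr: "\<lbrakk>A # \<Gamma> \<turnstile> B \<^bold>: Univ l; \<Gamma> \<turnstile> a \<^bold>\<equiv> a' \<^bold>: A; \<Gamma> \<turnstile> b \<^bold>\<equiv> b' \<^bold>: inst B a\<rbrakk>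
    \<Longrightarrow> \<Gamma> \<turnstile> Pr a b \<^bold>\<equiv> Pr a' b' \<^bold>: Sg A B"
| eq_Fst: "\<Gamma> \<turnstile> p \<^bold>\<equiv> p' \<^bold>: Sg A B \<Longrightarrow> \<Gamma> \<turnstile> Fst p \<^bold>\<equiv> Fst p' \<^bold>: A"
| eq_Snd: "\<Gamma> \<turnstile> p \<^bold>\<equiv> p' \<^bold>: Sg A B \<Longrightarrow> \<Gamma> \<turnstile> Snd p \<^bold>\<equiv> Snd p' \<^bold>: inst B (Fst p)"
| Fst_beta: "\<lbrakk>A # \<Gamma> \<turnstile> B \<^bold>: Univ l; \<Gamma> \<turnstile> a \<^bold>: A; \<Gamma> \<turnstile> b \<^bold>: inst B a\<rbrakk>
    \<Longrightarrow> \<Gamma> \<turnstile> Fst (Pr a b) \<^bold>\<equiv> a \<^bold>: A"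
| Snd_beta: "\<lbrakk>A # \<Gamma> \<turnstile> B \<^bold>: Univ l; \<Gamma> \<turnstile> a \<^bold>: A; \<Gamma> \<turnstile> b \<^bold>: inst B a\<rbrakk>
    \<Longrightarrow> \<Gamma> \<turnstile> Snd (Pr a b) \<^bold>\<equiv> b \<^bold>: inst B a"
| Sg_eta: "\<Gamma> \<turnstile> p \<^bold>: Sg A B \<Longrightarrow> \<Gamma> \<turnstile> Pr (Fst p) (Snd p) \<^bold>\<equiv> p \<^bold>: Sg A B"

| ty_Plus: "\<lbrakk>\<Gamma> \<turnstile> A \<^bold>: Univ l; \<Gamma> \<turnstile> B \<^bold>: Univ l\<rbrakk> \<Longrightarrow> \<Gamma> \<turnstile> Plus A B \<^bold>: Univ l"
| ty_InjL: "\<lbrakk>\<Gamma> \<turnstile> a \<^bold>: A; \<Gamma> \<turnstile> B \<^bold>: Univ l\<rbrakk> \<Longrightarrow> \<Gamma> \<turnstile> InjL a \<^bold>: Plus A B"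
| ty_InjR: "\<lbrakk>\<Gamma> \<turnstile> A \<^bold>: Univ l; \<Gamma> \<turnstile> b \<^bold>: B\<rbrakk> \<Longrightarrow> \<Gamma> \<turnstile> InjR b \<^bold>: Plus A B"
| ty_Case: "\<lbrakk>Plus A B # \<Gamma> \<turnstile> C \<^bold>: Univ l;
    A # \<Gamma> \<turnstile> c \<^bold>: subst (scons (InjL (Var 0)) (\<lambda>k. Var (Suc k))) C;
    B # \<Gamma> \<turnstile> d \<^bold>: subst (scons (InjR (Var 0)) (\<lambda>k. Var (Suc k))) C;
    \<Gamma> \<turnstile> t \<^bold>: Plus A B\<rbrakk>
    \<Longrightarrow> \<Gamma> \<turnstile> Case C c d t \<^bold>: inst C t"
| eq_Plus: "\<lbrakk>\<Gamma> \<turnstile> A \<^bold>\<equiv> A' \<^bold>: Univ l; \<Gamma> \<turnstile> B \<^bold>\<equiv> B' \<^bold>: Univ l\<rbrakk>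
    \<Longrightarrow> \<Gamma> \<turnstile> Plus A B \<^bold>\<equiv> Plus A' B' \<^bold>: Univ l"
| eq_InjL: "\<lbrakk>\<Gamma> \<turnstile> a \<^bold>\<equiv> a' \<^bold>: A; \<Gamma> \<turnstile> B \<^bold>: Univ l\<rbrakk> \<Longrightarrow> \<Gamma> \<turnstile> InjL a \<^bold>\<equiv> InjL a' \<^bold>: Plus A B"
| eq_InjR: "\<lbrakk>\<Gamma> \<turnstile> A \<^bold>: Univ l; \<Gamma> \<turnstile> b \<^bold>\<equiv> b' \<^bold>: B\<rbrakk> \<Longrightarrow> \<Gamma> \<turnstile> InjR b \<^bold>\<equiv> InjR b' \<^bold>: Plus A B"
| eq_Case: "\<lbrakk>Plus A B # \<Gamma> \<turnstile> C \<^bold>\<equiv> C' \<^bold>: Univ l;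
    A # \<Gamma> \<turnstile> c \<^bold>\<equiv> c' \<^bold>: subst (scons (InjL (Var 0)) (\<lambda>k. Var (Suc k))) C;
    B # \<Gamma> \<turnstile> d \<^bold>\<equiv> d' \<^bold>: subst (scons (InjR (Var 0)) (\<lambda>k. Var (Suc k))) C;
    \<Gamma> \<turnstile> t \<^bold>\<equiv> t' \<^bold>: Plus A B\<rbrakk>
    \<Longrightarrow> \<Gamma> \<turnstile> Case C c d t \<^bold>\<equiv> Case C' c' d' t' \<^bold>: inst C t"
| InjL_beta: "\<lbrakk>Plus A B # \<Gamma> \<turnstile> C \<^bold>: Univ l;
    A # \<Gamma> \<turnstile> c \<^bold>: subst (scons (InjL (Var 0)) (\<lambda>k. Var (Suc k))) C;
    B # \<Gamma> \<turnstile> d \<^bold>: subst (scons (InjR (Var 0)) (\<lambda>k. Var (Suc k))) C;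
    \<Gamma> \<turnstile> a \<^bold>: A\<rbrakk>
    \<Longrightarrow> \<Gamma> \<turnstile> Case C c d (InjL a) \<^bold>\<equiv> inst c a \<^bold>: inst C (InjL a)"
| InjR_beta: "\<lbrakk>Plus A B # \<Gamma> \<turnstile> C \<^bold>: Univ l;
    A # \<Gamma> \<turnstile> c \<^bold>: subst (scons (InjL (Var 0)) (\<lambda>k. Var (Suc k))) C;
    B # \<Gamma> \<turnstile> d \<^bold>: subst (scons (InjR (Var 0)) (\<lambda>k. Var (Suc k))) C;
    \<Gamma> \<turnstile> b \<^bold>: B\<rbrakk>
    \<Longrightarrow> \<Gamma> \<turnstile> Case C c d (InjR b) \<^bold>\<equiv> inst d b \<^bold>: inst C (InjR b)"

| ty_Empty: "\<turnstile> \<Gamma> \<Longrightarrow> \<Gamma> \<turnstile> Empty \<^bold>: Univ l"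
| ty_Abort: "\<lbrakk>Empty # \<Gamma> \<turnstile> C \<^bold>: Univ l; \<Gamma> \<turnstile> t \<^bold>: Empty\<rbrakk> \<Longrightarrow> \<Gamma> \<turnstile> Abort C t \<^bold>: inst C t"
| eq_Abort: "\<lbrakk>Empty # \<Gamma> \<turnstile> C \<^bold>\<equiv> C' \<^bold>: Univ l; \<Gamma> \<turnstile> t \<^bold>\<equiv> t' \<^bold>: Empty\<rbrakk>
    \<Longrightarrow> \<Gamma> \<turnstile> Abort C t \<^bold>\<equiv> Abort C' t' \<^bold>: inst C t"

| ty_Unit: "\<turnstile> \<Gamma> \<Longrightarrow> \<Gamma> \<turnstile> Unit \<^bold>: Univ l"
| ty_Star: "\<turnstile> \<Gamma> \<Longrightarrow> \<Gamma> \<turnstile> Star \<^bold>: Unit"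
| ty_UnitInd: "\<lbrakk>Unit # \<Gamma> \<turnstile> C \<^bold>: Univ l; \<Gamma> \<turnstile> c \<^bold>: inst C Star; \<Gamma> \<turnstile> t \<^bold>: Unit\<rbrakk>
    \<Longrightarrow> \<Gamma> \<turnstile> UnitInd C c t \<^bold>: inst C t"
| eq_UnitInd: "\<lbrakk>Unit # \<Gamma> \<turnstile> C \<^bold>\<equiv> C' \<^bold>: Univ l; \<Gamma> \<turnstile> c \<^bold>\<equiv> c' \<^bold>: inst C Star; \<Gamma> \<turnstile> t \<^bold>\<equiv> t' \<^bold>: Unit\<rbrakk>
    \<Longrightarrow> \<Gamma> \<turnstile> UnitInd C c t \<^bold>\<equiv> UnitInd C' c' t' \<^bold>: inst C t"
| Star_beta: "\<lbrakk>Unit # \<Gamma> \<turnstile> C \<^bold>: Univ l; \<Gamma> \<turnstile> c \<^bold>: inst C Star\<rbrakk>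
    \<Longrightarrow> \<Gamma> \<turnstile> UnitInd C c Star \<^bold>\<equiv> c \<^bold>: inst C Star"

| ty_Two: "\<turnstile> \<Gamma> \<Longrightarrow> \<Gamma> \<turnstile> Two \<^bold>: Univ l"
| ty_Zero2: "\<turnstile> \<Gamma> \<Longrightarrow> \<Gamma> \<turnstile> Zero2 \<^bold>: Two"
| ty_One2: "\<turnstile> \<Gamma> \<Longrightarrow> \<Gamma> \<turnstile> One2 \<^bold>: Two"
| ty_TwoInd: "\<lbrakk>Two # \<Gamma> \<turnstile> C \<^bold>: Univ l; \<Gamma> \<turnstile> c \<^bold>: inst C Zero2; \<Gamma> \<turnstile> d \<^bold>: inst C One2; \<Gamma> \<turnstile> t \<^bold>: Two\<rbrakk>
    \<Longrightarrow> \<Gamma> \<turnstile> TwoInd C c d t \<^bold>: inst C t"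
| eq_TwoInd: "\<lbrakk>Two # \<Gamma> \<turnstile> C \<^bold>\<equiv> C' \<^bold>: Univ l; \<Gamma> \<turnstile> c \<^bold>\<equiv> c' \<^bold>: inst C Zero2;
    \<Gamma> \<turnstile> d \<^bold>\<equiv> d' \<^bold>: inst C One2; \<Gamma> \<turnstile> t \<^bold>\<equiv> t' \<^bold>: Two\<rbrakk>
    \<Longrightarrow> \<Gamma> \<turnstile> TwoInd C c d t \<^bold>\<equiv> TwoInd C' c' d' t' \<^bold>: inst C t"
| Zero2_beta: "\<lbrakk>Two # \<Gamma> \<turnstile> C \<^bold>: Univ l; \<Gamma> \<turnstile> c \<^bold>: inst C Zero2; \<Gamma> \<turnstile> d \<^bold>: inst C One2\<rbrakk>
    \<Longrightarrow> \<Gamma> \<turnstile> TwoInd C c d Zero2 \<^bold>\<equiv> c \<^bold>: inst C Zero2"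
| One2_beta: "\<lbrakk>Two # \<Gamma> \<turnstile> C \<^bold>: Univ l; \<Gamma> \<turnstile> c \<^bold>: inst C Zero2; \<Gamma> \<turnstile> d \<^bold>: inst C One2\<rbrakk>
    \<Longrightarrow> \<Gamma> \<turnstile> TwoInd C c d One2 \<^bold>\<equiv> d \<^bold>: inst C One2"

| ty_Nat: "\<turnstile> \<Gamma> \<Longrightarrow> \<Gamma> \<turnstile> Nat \<^bold>: Univ l"
| ty_Zero: "\<turnstile> \<Gamma> \<Longrightarrow> \<Gamma> \<turnstile> Zero \<^bold>: Nat"
| ty_Succ: "\<Gamma> \<turnstile> n \<^bold>: Nat \<Longrightarrow> \<Gamma> \<turnstile> Succ n \<^bold>: Nat"
| ty_NatInd: "\<lbrakk>Nat # \<Gamma> \<turnstile> C \<^bold>: Univ l; \<Gamma> \<turnstile> c \<^bold>: inst C Zero;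
    C # Nat # \<Gamma> \<turnstile> d \<^bold>: subst (scons (Succ (Var 1)) (\<lambda>k. Var (k + 2))) C; \<Gamma> \<turnstile> n \<^bold>: Nat\<rbrakk>
    \<Longrightarrow> \<Gamma> \<turnstile> NatInd C c d n \<^bold>: inst C n"
| eq_Succ: "\<Gamma> \<turnstile> n \<^bold>\<equiv> n' \<^bold>: Nat \<Longrightarrow> \<Gamma> \<turnstile> Succ n \<^bold>\<equiv> Succ n' \<^bold>: Nat"
| eq_NatInd: "\<lbrakk>Nat # \<Gamma> \<turnstile> C \<^bold>\<equiv> C' \<^bold>: Univ l; \<Gamma> \<turnstile> c \<^bold>\<equiv> c' \<^bold>: inst C Zero;
    C # Nat # \<Gamma> \<turnstile> d \<^bold>\<equiv> d' \<^bold>: subst (scons (Succ (Var 1)) (\<lambda>k. Var (k + 2))) C; \<Gamma> \<turnstile> n \<^bold>\<equiv> n' \<^bold>: Nat\<rbrakk>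
    \<Longrightarrow> \<Gamma> \<turnstile> NatInd C c d n \<^bold>\<equiv> NatInd C' c' d' n' \<^bold>: inst C n"
| Zero_beta: "\<lbrakk>Nat # \<Gamma> \<turnstile> C \<^bold>: Univ l; \<Gamma> \<turnstile> c \<^bold>: inst C Zero;
    C # Nat # \<Gamma> \<turnstile> d \<^bold>: subst (scons (Succ (Var 1)) (\<lambda>k. Var (k + 2))) C\<rbrakk>
    \<Longrightarrow> \<Gamma> \<turnstile> NatInd C c d Zero \<^bold>\<equiv> c \<^bold>: inst C Zero"
| Succ_beta: "\<lbrakk>Nat # \<Gamma> \<turnstile> C \<^bold>: Univ l; \<Gamma> \<turnstile> c \<^bold>: inst C Zero;
    C # Nat # \<Gamma> \<turnstile> d \<^bold>: subst (scons (Succ (Var 1)) (\<lambda>k. Var (k + 2))) C; \<Gamma> \<turnstile> n \<^bold>: Nat\<rbrakk>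
    \<Longrightarrow> \<Gamma> \<turnstile> NatInd C c d (Succ n) \<^bold>\<equiv> inst2 d n (NatInd C c d n) \<^bold>: inst C (Succ n)"

| ty_Idt: "\<lbrakk>\<Gamma> \<turnstile> A \<^bold>: Univ l; \<Gamma> \<turnstile> a \<^bold>: A; \<Gamma> \<turnstile> b \<^bold>: A\<rbrakk> \<Longrightarrow> \<Gamma> \<turnstile> Idt A a b \<^bold>: Univ l"
| ty_Refl: "\<Gamma> \<turnstile> a \<^bold>: A \<Longrightarrow> \<Gamma> \<turnstile> Refl a \<^bold>: Idt A a a"
| ty_J: "\<lbrakk>\<Gamma> \<turnstile> a \<^bold>: A; Idt (wk A) (wk a) (Var 0) # A # \<Gamma> \<turnstile> C \<^bold>: Univ l;
    \<Gamma> \<turnstile> c \<^bold>: inst2 C a (Refl a); \<Gamma> \<turnstile> b \<^bold>: A; \<Gamma> \<turnstile> p \<^bold>: Idt A a b\<rbrakk>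
    \<Longrightarrow> \<Gamma> \<turnstile> J A a C c b p \<^bold>: inst2 C b p"
| eq_Idt: "\<lbrakk>\<Gamma> \<turnstile> A \<^bold>\<equiv> A' \<^bold>: Univ l; \<Gamma> \<turnstile> a \<^bold>\<equiv> a' \<^bold>: A; \<Gamma> \<turnstile> b \<^bold>\<equiv> b' \<^bold>: A\<rbrakk>
    \<Longrightarrow> \<Gamma> \<turnstile> Idt A a b \<^bold>\<equiv> Idt A' a' b' \<^bold>: Univ l"
| eq_Refl: "\<Gamma> \<turnstile> a \<^bold>\<equiv> a' \<^bold>: A \<Longrightarrow> \<Gamma> \<turnstile> Refl a \<^bold>\<equiv> Refl a' \<^bold>: Idt A a a"
| eq_J: "\<lbrakk>\<Gamma> \<turnstile> A \<^bold>\<equiv> A' \<^bold>: Univ m; \<Gamma> \<turnstile> a \<^bold>\<equiv> a' \<^bold>: A;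
    Idt (wk A) (wk a) (Var 0) # A # \<Gamma> \<turnstile> C \<^bold>\<equiv> C' \<^bold>: Univ l;
    \<Gamma> \<turnstile> c \<^bold>\<equiv> c' \<^bold>: inst2 C a (Refl a); \<Gamma> \<turnstile> b \<^bold>\<equiv> b' \<^bold>: A; \<Gamma> \<turnstile> p \<^bold>\<equiv> p' \<^bold>: Idt A a b\<rbrakk>
    \<Longrightarrow> \<Gamma> \<turnstile> J A a C c b p \<^bold>\<equiv> J A' a' C' c' b' p' \<^bold>: inst2 C b p"
| J_beta: "\<lbrakk>\<Gamma> \<turnstile> a \<^bold>: A; Idt (wk A) (wk a) (Var 0) # A # \<Gamma> \<turnstile> C \<^bold>: Univ l;
    \<Gamma> \<turnstile> c \<^bold>: inst2 C a (Refl a)\<rbrakk>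
    \<Longrightarrow> \<Gamma> \<turnstile> J A a C c a (Refl a) \<^bold>\<equiv> c \<^bold>: inst2 C a (Refl a)"

| ty_Trunc: "\<Gamma> \<turnstile> A \<^bold>: Univ l \<Longrightarrow> \<Gamma> \<turnstile> Trunc A \<^bold>: Univ l"
| ty_Inc: "\<Gamma> \<turnstile> a \<^bold>: A \<Longrightarrow> \<Gamma> \<turnstile> Inc a \<^bold>: Trunc A"
| ty_Squash: "\<lbrakk>\<Gamma> \<turnstile> x \<^bold>: Trunc A; \<Gamma> \<turnstile> y \<^bold>: Trunc A\<rbrakk> \<Longrightarrow> \<Gamma> \<turnstile> Squash x y \<^bold>: Idt (Trunc A) x y"
| ty_TruncRec: "\<lbrakk>\<Gamma> \<turnstile> B \<^bold>: Univ l; \<Gamma> \<turnstile> h \<^bold>: isProp B; \<Gamma> \<turnstile> f \<^bold>: A \<rightarrow>\<^sub>t B; \<Gamma> \<turnstile> x \<^bold>: Trunc A\<rbrakk>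
    \<Longrightarrow> \<Gamma> \<turnstile> TruncRec B h f x \<^bold>: B"
| eq_Trunc: "\<Gamma> \<turnstile> A \<^bold>\<equiv> A' \<^bold>: Univ l \<Longrightarrow> \<Gamma> \<turnstile> Trunc A \<^bold>\<equiv> Trunc A' \<^bold>: Univ l"
| eq_Inc: "\<Gamma> \<turnstile> a \<^bold>\<equiv> a' \<^bold>: A \<Longrightarrow> \<Gamma> \<turnstile> Inc a \<^bold>\<equiv> Inc a' \<^bold>: Trunc A"
| eq_Squash: "\<lbrakk>\<Gamma> \<turnstile> x \<^bold>\<equiv> x' \<^bold>: Trunc A; \<Gamma> \<turnstile> y \<^bold>\<equiv> y' \<^bold>: Trunc A\<rbrakk>
    \<Longrightarrow> \<Gamma> \<turnstile> Squash x y \<^bold>\<equiv> Squash x' y' \<^bold>: Idt (Trunc A) x y"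
| eq_TruncRec: "\<lbrakk>\<Gamma> \<turnstile> B \<^bold>\<equiv> B' \<^bold>: Univ l; \<Gamma> \<turnstile> h \<^bold>\<equiv> h' \<^bold>: isProp B; \<Gamma> \<turnstile> f \<^bold>\<equiv> f' \<^bold>: A \<rightarrow>\<^sub>t B;
    \<Gamma> \<turnstile> x \<^bold>\<equiv> x' \<^bold>: Trunc A\<rbrakk>
    \<Longrightarrow> \<Gamma> \<turnstile> TruncRec B h f x \<^bold>\<equiv> TruncRec B' h' f' x' \<^bold>: B"

| ty_Funext: "\<lbrakk>\<Gamma> \<turnstile> f \<^bold>: Pi A B; \<Gamma> \<turnstile> g \<^bold>: Pi A B;
    \<Gamma> \<turnstile> h \<^bold>: Pi A (Idt B (App (wk f) (Var 0)) (App (wk g) (Var 0)))\<rbrakk>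
    \<Longrightarrow> \<Gamma> \<turnstile> Funext f g h \<^bold>: Idt (Pi A B) f g"
| eq_Funext: "\<lbrakk>\<Gamma> \<turnstile> f \<^bold>\<equiv> f' \<^bold>: Pi A B; \<Gamma> \<turnstile> g \<^bold>\<equiv> g' \<^bold>: Pi A B;
    \<Gamma> \<turnstile> h \<^bold>\<equiv> h' \<^bold>: Pi A (Idt B (App (wk f) (Var 0)) (App (wk g) (Var 0)))\<rbrakk>
    \<Longrightarrow> \<Gamma> \<turnstile> Funext f g h \<^bold>\<equiv> Funext f' g' h' \<^bold>: Idt (Pi A B) f g"

| ty_Propext: "\<lbrakk>\<Gamma> \<turnstile> P \<^bold>: Univ l; \<Gamma> \<turnstile> Q \<^bold>: Univ l; \<Gamma> \<turnstile> p \<^bold>: isProp P; \<Gamma> \<turnstile> q \<^bold>: isProp Q;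
    \<Gamma> \<turnstile> f \<^bold>: P \<rightarrow>\<^sub>t Q; \<Gamma> \<turnstile> g \<^bold>: Q \<rightarrow>\<^sub>t P\<rbrakk>
    \<Longrightarrow> \<Gamma> \<turnstile> Propext P Q p q f g \<^bold>: Idt (Univ l) P Q"
| eq_Propext: "\<lbrakk>\<Gamma> \<turnstile> P \<^bold>\<equiv> P' \<^bold>: Univ l; \<Gamma> \<turnstile> Q \<^bold>\<equiv> Q' \<^bold>: Univ l; \<Gamma> \<turnstile> p \<^bold>\<equiv> p' \<^bold>: isProp P;
    \<Gamma> \<turnstile> q \<^bold>\<equiv> q' \<^bold>: isProp Q; \<Gamma> \<turnstile> f \<^bold>\<equiv> f' \<^bold>: P \<rightarrow>\<^sub>t Q; \<Gamma> \<turnstile> g \<^bold>\<equiv> g' \<^bold>: Q \<rightarrow>\<^sub>t P\<rbrakk>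
    \<Longrightarrow> \<Gamma> \<turnstile> Propext P Q p q f g \<^bold>\<equiv> Propext P' Q' p' q' f' g' \<^bold>: Idt (Univ l) P Q"

definition provable :: "tm \<Rightarrow> bool" where
  "provable A \<longleftrightarrow> (\<exists>t. [] \<turnstile> t \<^bold>: A)"


section \<open>The notions and principles of the statement\<close>

definition neg :: "tm \<Rightarrow> tm" where
  "neg A = (A \<rightarrow>\<^sub>t Empty)"

definition isSet :: "tm \<Rightarrow> tm" where
  "isSet A = Pi A (Pi (wk A) (isProp (Idt (wk (wk A)) (Var 1) (Var 0))))"

definition Cantor :: tm where
  "Cantor = (Nat \<rightarrow>\<^sub>t Two)"

text \<open>\<open>holds_at \<alpha> n\<close> is the type \<open>\<alpha>\<^sub>n = 1\<close>, and
  \<open>extent \<alpha>\<close> is the type written with angle brackets around \<open>\<alpha>\<close>.\<close>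

definition holds_at :: "tm \<Rightarrow> tm \<Rightarrow> tm" where
  "holds_at \<alpha> n = Idt Two (App \<alpha> n) One2"

definition extent :: "tm \<Rightarrow> tm" where
  "extent \<alpha> = Sg Nat (holds_at (wk \<alpha>) (Var 0))"

definition Ninf :: tm where
  "Ninf = Sg Cantor (isProp (extent (Var 0)))"

text \<open>
  In the following, \<open>l\<close> is the level of the ambient universe. The \<open>let\<close>
  names stand for de Bruijn indices; where \<open>n\<close> occurs, all indices are those valid
  below the binder of \<open>Pi Nat\<close>. The function arrow does its own weakening.
\<close>

definition rosoliniStructure :: "nat \<Rightarrow> tm \<Rightarrow> tm" where
  "rosoliniStructure l P = Sg Ninf (Idt (Univ l) (wk P) (extent (Fst (Var 0))))"

definition isRosolini :: "nat \<Rightarrow> tm \<Rightarrow> tm" where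
  "isRosolini l P = Trunc (rosoliniStructure l P)"

definition RosoliniChoice :: "nat \<Rightarrow> tm" where
  "RosoliniChoice l =
     Pi (Univ l) (Pi (Univ l)
       (let P = Var 1; Q = Var 0 in
         isRosolini l P \<rightarrow>\<^sub>t (P \<rightarrow>\<^sub>t Trunc (rosoliniStructure l Q)) \<rightarrow>\<^sub>t
         Trunc (P \<rightarrow>\<^sub>t rosoliniStructure l Q)))"

definition CountableChoice :: "nat \<Rightarrow> tm" where
  "CountableChoice l =
     Pi (Nat \<rightarrow>\<^sub>t Univ l)
       (let Y = Var 1; n = Var 0 in
         Pi Nat (Trunc (App Y n)) \<rightarrow>\<^sub>t Trunc (Pi Nat (App Y n)))"

definition SemidecidableChoice :: "nat \<Rightarrow> tm" where
  "SemidecidableChoice l =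
     Pi (Univ l) (Pi Cantor
       (let A = Var 2; \<alpha> = Var 1; n = Var 0 in
         Pi Nat (Trunc (holds_at \<alpha> n \<rightarrow>\<^sub>t A)) \<rightarrow>\<^sub>t Trunc (Pi Nat (holds_at \<alpha> n \<rightarrow>\<^sub>t A))))"

definition LPO :: tm where
  "LPO = Pi Cantor (let \<alpha> = Var 0 in Plus (extent \<alpha>) (Idt Cantor \<alpha> (Lam Nat Zero2)))"

definition WLPO :: tm where
  "WLPO = Pi Cantor (let \<alpha> = Var 0 in Plus (extent \<alpha>) (neg (extent \<alpha>)))"

definition TruncatedWLPO :: tm where
  "TruncatedWLPO = Pi Cantor (let \<alpha> = Var 0 in Trunc (Plus (extent \<alpha>) (neg (extent \<alpha>))))"

definition PropositionalChoice :: "nat \<Rightarrow> tm" where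
  "PropositionalChoice l =
     Pi (Univ l) (Pi (Univ l)
       (let P = Var 1; A = Var 0 in
         isSet A \<rightarrow>\<^sub>t isProp P \<rightarrow>\<^sub>t (P \<rightarrow>\<^sub>t Trunc A) \<rightarrow>\<^sub>t Trunc (P \<rightarrow>\<^sub>t A)))"

end

theory Submission
  imports Defs
begin

text \<open>
  LPO implies WLPO, which implies its truncation. If \<open>P\<close> is the extent of \<open>u\<close>, truncated WLPO decides
  \<open>P\<close> up to truncation, and in either case a map from \<open>P\<close> into a truncation lifts. Countable choice
  implies principle (2) by taking the family \<open>(\<alpha>\<^sub>n = 1) \<rightarrow> A\<close>; to apply (2), decide each
  \<open>\<alpha>\<^sub>n = 1\<close>, choose, and evaluate at the index provided by an element of \<open>P\<close>.

  For the choice principles one has to replace the Rosolini structures on \<open>Q\<close>, which form a type in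
  the next universe, by the logically equivalent small type of all \<open>u\<close> for which \<open>Q\<close> is a proposition
  equivalent to the extent of \<open>u\<close>. For propositional choice this type must be a set: by function
  extensionality its identity types are equivalent to the proposition that two binary sequences agree
  pointwise, and Hedberg's argument applies.
\<close>

section \<open>Renaming and substitution\<close>

text \<open>Each implication is proved inside the type theory: the principle is a variable of the
  context and has to be applied to arguments built from \<open>P\<close>, \<open>Q\<close> and the
  structure on \<open>P\<close>. Truncations can be eliminated only into propositions, which costs
  nothing here because the conclusion of Rosolini choice is itself truncated; for the same reason a
  truncated decision is as useful as an untruncated one. Lifting a map from \<open>P\<close> into a
  truncation is a problem only as long as \<open>P\<close> is undecided. Its description as an
  extent replaces \<open>P\<close> by the decidable types \<alpha>_n = 1. For a single n the lifting
  is a case distinction, and a choice principle is needed only to perform it for all n at once. A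
  technical constraint is definitional equality. A term to which later types refer is made a
  variable by a cut where possible, so that its type can be computed syntactically; explicit
  conversion is confined to a few beta and eta steps.\<close>

lemma upren_simps [simp]: "upren r 0 = 0" "upren r (Suc k) = Suc (r k)"
  by (simp_all add: upren_def)

lemma scons_simps [simp]: "scons a s 0 = a" "scons a s (Suc k) = s k"
  by (simp_all add: scons_def)

lemma up_simps [simp]: "up s 0 = Var 0" "up s (Suc k) = wk (s k)"
  by (simp_all add: up_def)

lemma upren_comp: "(\<lambda>k. upren r (upren r' k)) = upren (\<lambda>k. r (r' k))"
proof
  fix k show "upren r (upren r' k) = upren (\<lambda>k. r (r' k)) k" by (cases k) auto
qed

lemma ren_ren: "ren r (ren r' t) = ren (\<lambda>k. r (r' k)) t"
  by (induction t arbitrary: r r') (auto simp: upren_comp)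

lemma up_upren: "(\<lambda>k. up s (upren r k)) = up (\<lambda>k. s (r k))"
proof
  fix k show "up s (upren r k) = up (\<lambda>k. s (r k)) k" by (cases k) auto
qed

lemma subst_ren: "subst s (ren r t) = subst (\<lambda>k. s (r k)) t"
  by (induction t arbitrary: s r) (auto simp: up_upren)

lemma ren_up: "(\<lambda>k. ren (upren r) (up s k)) = up (\<lambda>k. ren r (s k))"
proof
  fix k show "ren (upren r) (up s k) = up (\<lambda>k. ren r (s k)) k" by (cases k) (auto simp: ren_ren)
qed

lemma ren_subst: "ren r (subst s t) = subst (\<lambda>k. ren r (s k)) t"
  by (induction t arbitrary: s r) (auto simp: ren_up)

lemma up_Var: "up (\<lambda>k. Var (r k)) = (\<lambda>k. Var (upren r k))"
proof
  fix k show "up (\<lambda>k. Var (r k)) k = Var (upren r k)" by (cases k) auto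
qed

lemma subst_Var_ren: "subst (\<lambda>k. Var (r k)) t = ren r t"
  by (induction t arbitrary: r) (auto simp: up_Var)

lemma subst_Var [simp]: "subst Var t = t"
proof -
  have "upren (\<lambda>k. k) = (\<lambda>k. k)"
  proof
    fix k show "upren (\<lambda>k. k) k = k" by (cases k) auto
  qed
  then have "ren (\<lambda>k. k) t = t" by (induction t) auto
  then show ?thesis using subst_Var_ren[of "\<lambda>k. k" t] by simp
qed

lemma ren_upren_wk [simp]: "ren (upren r) (wk t) = wk (ren r t)"
  by (simp add: ren_ren)

lemma subst_up_wk [simp]: "subst (up s) (wk t) = wk (subst s t)"
  by (simp add: subst_ren ren_subst)

lemma subst_scons_wk [simp]: "subst (scons a s) (wk t) = subst s t"
  by (simp add: subst_ren)

text \<open>This restores a codomain that was weakened below its binder and then instantiated at the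
  new variable, as happens in the type of \<open>App (wk f) v0\<close>.\<close>

lemma subst_scons_upren_wk [simp]: "subst (scons (Var 0) Var) (ren (upren Suc) t) = t"
proof -
  have "(\<lambda>k. scons (Var 0) Var (upren Suc k)) = Var"
  proof
    fix k show "scons (Var 0) Var (upren Suc k) = Var k" by (cases k) auto
  qed
  then show ?thesis by (simp add: subst_ren)
qed

lemma up_Var_id [simp]: "up Var = Var"
proof
  fix k show "up Var k = Var k" by (cases k) auto
qed

lemma subst_up_scons_upren_wk [simp]:
  "subst (up (scons a s)) (ren (upren Suc) t) = subst (up s) t"
  by (simp add: subst_ren up_upren)

lemma subst_up_up_upren_wk [simp]:
  "subst (up (up s)) (ren (upren Suc) t) = ren (upren Suc) (subst (up s) t)"
  by (simp add: subst_ren ren_subst up_upren ren_up)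

lemma inst_wk [simp]: "inst (wk t) a = t"
  by (simp add: inst_def)

lemma inst2_wk [simp]: "inst2 (wk t) a b = inst t a"
  by (simp add: inst_def inst2_def)

lemma ren_inst: "ren r (inst t a) = inst (ren (upren r) t) (ren r a)"
proof -
  have "(\<lambda>k. ren r (scons a Var k)) = (\<lambda>k. scons (ren r a) Var (upren r k))"
  proof
    fix k show "ren r (scons a Var k) = scons (ren r a) Var (upren r k)" by (cases k) auto
  qed
  then show ?thesis by (simp add: inst_def ren_subst subst_ren)
qed

definition times :: "tm \<Rightarrow> tm \<Rightarrow> tm"  (infixr "\<times>\<^sub>t" 65) where
  "A \<times>\<^sub>t B = Sg A (wk B)"

text \<open>The derived notions stay folded under renaming (and under substitution, below), so that
  computed types match the stated ones literally.\<close>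

lemma ren_defs [simp]:
  "ren r (A \<rightarrow>\<^sub>t B) = ren r A \<rightarrow>\<^sub>t ren r B"
  "ren r (A \<times>\<^sub>t B) = ren r A \<times>\<^sub>t ren r B"
  "ren r (isProp A) = isProp (ren r A)"
  "ren r (isSet A) = isSet (ren r A)"
  "ren r (neg A) = neg (ren r A)"
  "ren r Cantor = Cantor"
  "ren r (holds_at a n) = holds_at (ren r a) (ren r n)"
  "ren r (extent a) = extent (ren r a)"
  "ren r Ninf = Ninf"
  "ren r (rosoliniStructure l P) = rosoliniStructure l (ren r P)"
  by (simp_all add: arr_def times_def isProp_def isSet_def neg_def Cantor_def holds_at_def extent_def
      Ninf_def rosoliniStructure_def)

lemma subst_defs [simp]:
  "subst s (A \<rightarrow>\<^sub>t B) = subst s A \<rightarrow>\<^sub>t subst s B"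
  "subst s (A \<times>\<^sub>t B) = subst s A \<times>\<^sub>t subst s B"
  "subst s (isProp A) = isProp (subst s A)"
  "subst s (isSet A) = isSet (subst s A)"
  "subst s (neg A) = neg (subst s A)"
  "subst s Cantor = Cantor"
  "subst s (holds_at a n) = holds_at (subst s a) (subst s n)"
  "subst s (extent a) = extent (subst s a)"
  "subst s Ninf = Ninf"
  "subst s (rosoliniStructure l P) = rosoliniStructure l (subst s P)"
  by (simp_all add: arr_def times_def isProp_def isSet_def neg_def Cantor_def holds_at_def extent_def
      Ninf_def rosoliniStructure_def)

abbreviation "v0 \<equiv> Var 0"
abbreviation "v1 \<equiv> Var (Suc 0)"
abbreviation "v2 \<equiv> Var (Suc (Suc 0))"
abbreviation "v3 \<equiv> Var (Suc (Suc (Suc 0)))"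
abbreviation "v4 \<equiv> Var (Suc (Suc (Suc (Suc 0))))"
abbreviation "v5 \<equiv> Var (Suc (Suc (Suc (Suc (Suc 0)))))"
abbreviation "v6 \<equiv> Var (Suc (Suc (Suc (Suc (Suc (Suc 0))))))"
abbreviation "v7 \<equiv> Var (Suc (Suc (Suc (Suc (Suc (Suc (Suc 0)))))))"


section \<open>Structural properties\<close>

text \<open>The induction needs all suffixes: a rule with premises below a binder only provides an
  extended context, and dropping its head gives the context of the conclusion.\<close>

lemma ctx_drop:
  "\<turnstile> \<Gamma> \<Longrightarrow> \<forall>n. \<turnstile> drop n \<Gamma>"
  "\<Gamma> \<turnstile> a \<^bold>: A \<Longrightarrow> \<forall>n. \<turnstile> drop n \<Gamma>"
  "\<Gamma> \<turnstile> a \<^bold>\<equiv> b \<^bold>: A \<Longrightarrow> \<forall>n. \<turnstile> drop n \<Gamma>"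
proof (induction rule: ctx_has_ty_eq_tm.inducts)
  case ctx_nil
  then show ?case by (simp add: ctx_has_ty_eq_tm.ctx_nil)
next
  case (ctx_cons \<Gamma> A l)
  then show ?case by (metis ctx_has_ty_eq_tm.ctx_cons drop_Cons')
qed (auto, (metis drop_Suc_Cons)+)

lemma ctx_of_ty: "\<Gamma> \<turnstile> a \<^bold>: A \<Longrightarrow> \<turnstile> \<Gamma>"
  using ctx_drop(2) by (metis drop0)

lemma ctx_ConsD:
  assumes "\<turnstile> A # \<Gamma>"
  shows "\<turnstile> \<Gamma>" "\<exists>l. \<Gamma> \<turnstile> A \<^bold>: Univ l"
proof -
  show "\<turnstile> \<Gamma>" using ctx_drop(1)[OF assms] by (metis drop_Suc_Cons drop0)
  show "\<exists>l. \<Gamma> \<turnstile> A \<^bold>: Univ l" using assms by (cases rule: ctx.cases) auto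
qed

lemma ty_weaken:
  assumes "\<Gamma> \<turnstile> t \<^bold>: A" "\<turnstile> B # \<Gamma>"
  shows "B # \<Gamma> \<turnstile> wk t \<^bold>: wk A"
proof -
  have "B # \<Gamma> \<turnstile> Var (Suc k) \<^bold>: subst (\<lambda>k. Var (Suc k)) (ren (\<lambda>m. m + Suc k) (\<Gamma> ! k))"
    if "k < length \<Gamma>" for k
    using ty_var[OF assms(2), of "Suc k"] that by (simp add: subst_Var_ren ren_ren)
  from ty_subst[OF assms this] show ?thesis by (simp add: subst_Var_ren)
qed

text \<open>The fresh variable is inserted beneath the innermost one, so the renaming fixes index 0.
  This is the weakening needed for codomains.\<close>

lemma ty_weaken_under:
  assumes "A # \<Gamma> \<turnstile> t \<^bold>: C" "\<turnstile> wk A # B # \<Gamma>"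
  shows "wk A # B # \<Gamma> \<turnstile> ren (upren Suc) t \<^bold>: ren (upren Suc) C"
proof -
  have "wk A # B # \<Gamma> \<turnstile> Var (upren Suc k)
      \<^bold>: subst (\<lambda>k. Var (upren Suc k)) (ren (\<lambda>m. m + Suc k) ((A # \<Gamma>) ! k))"
    if "k < length (A # \<Gamma>)" for k
  proof (cases k)
    case 0
    then show ?thesis using ty_var[OF assms(2), of 0] by (simp add: subst_Var_ren ren_ren)
  next
    case (Suc j)
    then show ?thesis using ty_var[OF assms(2), of "Suc (Suc j)"] that
      by (simp add: subst_Var_ren ren_ren)
  qed
  from ty_subst[OF assms this] show ?thesis by (simp add: subst_Var_ren)
qed

lemma ty_inst:
  assumes "A # \<Gamma> \<turnstile> t \<^bold>: B" "\<Gamma> \<turnstile> a \<^bold>: A"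
  shows "\<Gamma> \<turnstile> inst t a \<^bold>: inst B a"
proof -
  have ctx: "\<turnstile> \<Gamma>" using assms(2) by (rule ctx_of_ty)
  have "\<Gamma> \<turnstile> scons a Var k \<^bold>: subst (scons a Var) (ren (\<lambda>m. m + Suc k) ((A # \<Gamma>) ! k))"
    if "k < length (A # \<Gamma>)" for k
  proof (cases k)
    case 0
    then show ?thesis using assms(2) by simp
  next
    case (Suc j)
    then show ?thesis using ty_var[OF ctx, of j] that by (simp add: subst_ren subst_Var_ren)
  qed
  from ty_subst[OF assms(1) ctx this] show ?thesis by (simp add: inst_def)
qed

section \<open>Inhabitation\<close>

text \<open>
  The three judgements below presuppose that the context is well formed, so that type formation has
  to be checked only when a context is extended. Most proof terms are irrelevant for provability and
  remain implicit in \<open>\<Gamma> \<tturnstile> A\<close>.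
\<close>

definition wt :: "tm list \<Rightarrow> tm \<Rightarrow> tm \<Rightarrow> bool" where
  "wt \<Gamma> t A \<longleftrightarrow> (\<turnstile> \<Gamma> \<longrightarrow> \<Gamma> \<turnstile> t \<^bold>: A)"

definition ty :: "tm list \<Rightarrow> tm \<Rightarrow> bool" where
  "ty \<Gamma> A \<longleftrightarrow> (\<turnstile> \<Gamma> \<longrightarrow> (\<exists>l. \<Gamma> \<turnstile> A \<^bold>: Univ l))"

definition inh :: "tm list \<Rightarrow> tm \<Rightarrow> bool"  ("_ \<tturnstile> _" [40, 40] 40) where
  "\<Gamma> \<tturnstile> A \<longleftrightarrow> (\<turnstile> \<Gamma> \<longrightarrow> (\<exists>t. \<Gamma> \<turnstile> t \<^bold>: A))"

text \<open>
  Type synthesis for neutral terms. Types are compared syntactically, without conversion, so that the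
  simplifier can evaluate it.
\<close>

fun var_ty :: "tm list \<Rightarrow> nat \<Rightarrow> tm option" where
  "var_ty [] k = None"
| "var_ty (A # \<Gamma>) 0 = Some (wk A)"
| "var_ty (A # \<Gamma>) (Suc k) = map_option wk (var_ty \<Gamma> k)"

fun dest_Pi :: "tm \<Rightarrow> (tm \<times> tm) option" where
  "dest_Pi (Pi A B) = Some (A, B)"
| "dest_Pi _ = None"

fun dest_Sg :: "tm \<Rightarrow> (tm \<times> tm) option" where
  "dest_Sg (Sg A B) = Some (A, B)"
| "dest_Sg _ = None"

fun nty :: "tm list \<Rightarrow> tm \<Rightarrow> tm option" where
  "nty \<Gamma> (Var k) = var_ty \<Gamma> k"
| "nty \<Gamma> (App f a) = Option.bind (Option.bind (nty \<Gamma> f) dest_Pi)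
     (\<lambda>(A, B). if nty \<Gamma> a = Some A then Some (inst B a) else None)"
| "nty \<Gamma> (Fst p) = map_option fst (Option.bind (nty \<Gamma> p) dest_Sg)"
| "nty \<Gamma> (Snd p) = map_option (\<lambda>(A, B). inst B (Fst p)) (Option.bind (nty \<Gamma> p) dest_Sg)"
| "nty \<Gamma> (Refl a) = map_option (\<lambda>A. Idt A a a) (nty \<Gamma> a)"
| "nty \<Gamma> Zero2 = Some Two"
| "nty \<Gamma> One2 = Some Two"
| "nty \<Gamma> Star = Some Unit"
| "nty \<Gamma> _ = None"

lemma var_ty_sound: "\<turnstile> \<Gamma> \<Longrightarrow> var_ty \<Gamma> k = Some A \<Longrightarrow> \<Gamma> \<turnstile> Var k \<^bold>: A"
proof (induction \<Gamma> k arbitrary: A rule: var_ty.induct)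
  case (2 B \<Gamma>)
  then show ?case using ty_var[of "B # \<Gamma>" 0] by simp
next
  case (3 B \<Gamma> k)
  then obtain A' where "var_ty \<Gamma> k = Some A'" "A = wk A'" by auto
  then show ?case using 3 ty_weaken[of \<Gamma> "Var k" A' B] ctx_ConsD by auto
qed auto

lemma dest_Pi_Some: "dest_Pi F = Some (A, B) \<Longrightarrow> F = Pi A B"
  by (cases F) auto

lemma dest_Sg_Some: "dest_Sg F = Some (A, B) \<Longrightarrow> F = Sg A B"
  by (cases F) auto

lemma nty_sound: "\<turnstile> \<Gamma> \<Longrightarrow> nty \<Gamma> t = Some A \<Longrightarrow> \<Gamma> \<turnstile> t \<^bold>: A"
proof (induction \<Gamma> t arbitrary: A rule: nty.induct)
  case (2 \<Gamma> f a)
  then show ?case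
    by (auto split: bind_splits if_splits dest!: dest_Pi_Some intro: ty_App)
qed (auto split: bind_splits dest!: dest_Sg_Some
    intro: var_ty_sound ty_Fst ty_Snd ty_Refl ty_Zero2 ty_One2 ty_Star)

text \<open>A derived notion reveals its outermost product only when a term of that type is applied;
  elsewhere it remains folded.\<close>

lemma dest_Pi_defs [simp]:
  "dest_Pi (A \<rightarrow>\<^sub>t B) = Some (A, wk B)"
  "dest_Pi (neg A) = Some (A, Empty)"
  "dest_Pi (isProp A) = Some (A, Pi (wk A) (Idt (wk (wk A)) v1 v0))"
  "dest_Pi (isSet A) = Some (A, Pi (wk A) (isProp (Idt (wk (wk A)) v1 v0)))"
  "dest_Pi Cantor = Some (Nat, Two)"
  by (simp_all add: arr_def neg_def isProp_def isSet_def Cantor_def)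

lemma dest_Sg_defs [simp]:
  "dest_Sg (A \<times>\<^sub>t B) = Some (A, wk B)"
  "dest_Sg (extent a) = Some (Nat, holds_at (wk a) v0)"
  "dest_Sg Ninf = Some (Cantor, isProp (extent v0))"
  "dest_Sg (rosoliniStructure l P) = Some (Ninf, Idt (Univ l) (wk P) (extent (Fst v0)))"
  by (simp_all add: times_def extent_def Ninf_def rosoliniStructure_def)

lemma wt_nty: "nty \<Gamma> t = Some A \<Longrightarrow> wt \<Gamma> t A"
  by (simp add: wt_def nty_sound)

lemma wt_wk: "wt \<Gamma> t A \<Longrightarrow> wt (B # \<Gamma>) (wk t) (wk A)"
  by (auto simp: wt_def dest: ctx_ConsD intro: ty_weaken)

lemma wt_wk_Univ: "wt \<Gamma> A (Univ l) \<Longrightarrow> wt (B # \<Gamma>) (wk A) (Univ l)"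
  using wt_wk[of \<Gamma> A "Univ l"] by simp

lemma ty_wk: "ty \<Gamma> A \<Longrightarrow> ty (B # \<Gamma>) (wk A)"
  unfolding ty_def by (metis ctx_ConsD(1) ren.simps(2) ty_weaken)

lemma inh_wk: "\<Gamma> \<tturnstile> A \<Longrightarrow> B # \<Gamma> \<tturnstile> wk A"
  by (auto simp: inh_def dest: ctx_ConsD intro: ty_weaken)

lemma ctx_Cons: "ty \<Gamma> A \<Longrightarrow> \<turnstile> \<Gamma> \<Longrightarrow> \<turnstile> A # \<Gamma>"
  by (auto simp: ty_def intro: ctx_cons)

lemma ty_wt: "wt \<Gamma> A (Univ l) \<Longrightarrow> ty \<Gamma> A"
  by (auto simp: wt_def ty_def)

section \<open>Type formation, at a fixed universe level and at an unspecified one\<close>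

fun is_Univ :: "tm option \<Rightarrow> bool" where
  "is_Univ (Some (Univ l)) = True"
| "is_Univ _ = False"

lemma ty_nty: "is_Univ (nty \<Gamma> A) \<Longrightarrow> ty \<Gamma> A"
  by (cases "nty \<Gamma> A" rule: is_Univ.cases) (auto intro: ty_wt wt_nty)

lemma ty_cumul_le: "\<Gamma> \<turnstile> A \<^bold>: Univ l \<Longrightarrow> l \<le> m \<Longrightarrow> \<Gamma> \<turnstile> A \<^bold>: Univ m"
  by (rotate_tac, induction m rule: dec_induct) (auto intro: ty_cumul)

lemma wt_formation:
  "wt \<Gamma> Nat (Univ l)" "wt \<Gamma> Two (Univ l)" "wt \<Gamma> Empty (Univ l)" "wt \<Gamma> Unit (Univ l)"
  "wt \<Gamma> A (Univ l) \<Longrightarrow> wt (A # \<Gamma>) B (Univ l) \<Longrightarrow> wt \<Gamma> (Pi A B) (Univ l)"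
  "wt \<Gamma> A (Univ l) \<Longrightarrow> wt (A # \<Gamma>) B (Univ l) \<Longrightarrow> wt \<Gamma> (Sg A B) (Univ l)"
  "wt \<Gamma> A (Univ l) \<Longrightarrow> wt \<Gamma> B (Univ l) \<Longrightarrow> wt \<Gamma> (Plus A B) (Univ l)"
  "wt \<Gamma> A (Univ l) \<Longrightarrow> wt \<Gamma> a A \<Longrightarrow> wt \<Gamma> b A \<Longrightarrow> wt \<Gamma> (Idt A a b) (Univ l)"
  by (auto simp: wt_def intro: ty_Nat ty_Two ty_Empty ty_Unit ty_Pi ty_Sg ty_Plus ty_Idt ctx_cons)

lemma wt_formation_defs:
  "wt \<Gamma> A (Univ l) \<Longrightarrow> wt \<Gamma> B (Univ l) \<Longrightarrow> wt \<Gamma> (A \<rightarrow>\<^sub>t B) (Univ l)"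
  "wt \<Gamma> A (Univ l) \<Longrightarrow> wt \<Gamma> B (Univ l) \<Longrightarrow> wt \<Gamma> (A \<times>\<^sub>t B) (Univ l)"
  "wt \<Gamma> A (Univ l) \<Longrightarrow> wt \<Gamma> (isProp A) (Univ l)"
  "wt \<Gamma> Cantor (Univ l)"
  "wt \<Gamma> a Cantor \<Longrightarrow> wt \<Gamma> n Nat \<Longrightarrow> wt \<Gamma> (holds_at a n) (Univ l)"
  "wt \<Gamma> a Cantor \<Longrightarrow> wt \<Gamma> (extent a) (Univ l)"
  "wt \<Gamma> Ninf (Univ l)"
proof -
  have holds: "wt \<Gamma> (holds_at a n) (Univ l)" if "wt \<Gamma> a Cantor" "wt \<Gamma> n Nat" for \<Gamma> a n
  proof -
    have "wt \<Gamma> (App a n) Two"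
      using that ty_App[of \<Gamma> a Nat Two n] by (auto simp: wt_def Cantor_def arr_def inst_def)
    then show ?thesis by (simp add: holds_at_def wt_formation wt_nty)
  qed
  have ext: "wt \<Gamma> (extent a) (Univ l)" if "wt \<Gamma> a Cantor" for \<Gamma> a
    using wt_wk[OF that, of Nat] by (simp add: extent_def wt_formation holds wt_nty)
  have propn: "wt \<Gamma> (isProp A) (Univ l)" if "wt \<Gamma> A (Univ l)" for \<Gamma> A
    using that by (simp add: isProp_def wt_formation wt_wk_Univ wt_nty)
  have Cantor: "wt \<Gamma> Cantor (Univ l)" for \<Gamma>
    by (simp add: Cantor_def arr_def wt_formation)
  show "wt \<Gamma> (A \<rightarrow>\<^sub>t B) (Univ l)" "wt \<Gamma> (A \<times>\<^sub>t B) (Univ l)"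
    if "wt \<Gamma> A (Univ l)" "wt \<Gamma> B (Univ l)"
    using that by (simp_all add: arr_def times_def wt_formation wt_wk_Univ)
  show "wt \<Gamma> Ninf (Univ l)"
    by (simp add: Ninf_def wt_formation ext propn Cantor wt_nty)
  show "wt \<Gamma> (isProp A) (Univ l)" if "wt \<Gamma> A (Univ l)" using that by (rule propn)
  show "wt \<Gamma> Cantor (Univ l)" by (rule Cantor)
  show "wt \<Gamma> (holds_at a n) (Univ l)" if "wt \<Gamma> a Cantor" "wt \<Gamma> n Nat"
    using that by (rule holds)
  show "wt \<Gamma> (extent a) (Univ l)" if "wt \<Gamma> a Cantor" using that by (rule ext)
qed

lemma ty_formation:
  "ty \<Gamma> (Univ l)"
  "ty \<Gamma> A \<Longrightarrow> ty (A # \<Gamma>) B \<Longrightarrow> ty \<Gamma> (Pi A B)"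
  "ty \<Gamma> A \<Longrightarrow> ty (A # \<Gamma>) B \<Longrightarrow> ty \<Gamma> (Sg A B)"
  "ty \<Gamma> A \<Longrightarrow> ty \<Gamma> B \<Longrightarrow> ty \<Gamma> (Plus A B)"
  "ty \<Gamma> A \<Longrightarrow> wt \<Gamma> a A \<Longrightarrow> wt \<Gamma> b A \<Longrightarrow> ty \<Gamma> (Idt A a b)"
  "ty \<Gamma> A \<Longrightarrow> ty \<Gamma> (Trunc A)"
proof -
  show "ty \<Gamma> (Univ l)" by (auto simp: ty_def intro: ty_univ)
  \<comment> \<open>The formation rules want one level for both components; cumulativity lifts both
    to the maximum.\<close>
  have max: "\<exists>l. \<Gamma> \<turnstile> A \<^bold>: Univ l \<and> \<Delta> \<turnstile> B \<^bold>: Univ l"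
    if "\<Gamma> \<turnstile> A \<^bold>: Univ i" "\<Delta> \<turnstile> B \<^bold>: Univ j" for \<Gamma> \<Delta> A B i j
    by (rule exI[of _ "max i j"]) (auto intro: ty_cumul_le that)
  show "ty \<Gamma> (Pi A B)" "ty \<Gamma> (Sg A B)" if "ty \<Gamma> A" "ty (A # \<Gamma>) B"
    using that ctx_Cons[OF that(1)] unfolding ty_def by (metis max ty_Pi ty_Sg)+
  show "ty \<Gamma> (Plus A B)" if "ty \<Gamma> A" "ty \<Gamma> B"
    using that unfolding ty_def by (metis max ty_Plus)
  show "ty \<Gamma> (Idt A a b)" if "ty \<Gamma> A" "wt \<Gamma> a A" "wt \<Gamma> b A"
    using that unfolding ty_def wt_def by (blast intro: ty_Idt)
  show "ty \<Gamma> (Trunc A)" if "ty \<Gamma> A"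
    using that unfolding ty_def by (blast intro: ty_Trunc)
qed

lemma ty_formation_defs:
  "ty \<Gamma> A \<Longrightarrow> ty \<Gamma> B \<Longrightarrow> ty \<Gamma> (A \<rightarrow>\<^sub>t B)"
  "ty \<Gamma> A \<Longrightarrow> ty \<Gamma> B \<Longrightarrow> ty \<Gamma> (A \<times>\<^sub>t B)"
  "ty \<Gamma> A \<Longrightarrow> ty \<Gamma> (isProp A)"
  "ty \<Gamma> A \<Longrightarrow> ty \<Gamma> (isSet A)"
  "ty \<Gamma> A \<Longrightarrow> ty \<Gamma> (neg A)"
  "ty \<Gamma> Cantor"
  "wt \<Gamma> a Cantor \<Longrightarrow> wt \<Gamma> n Nat \<Longrightarrow> ty \<Gamma> (holds_at a n)"
  "wt \<Gamma> a Cantor \<Longrightarrow> ty \<Gamma> (extent a)"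
  "ty \<Gamma> Ninf"
  "ty \<Gamma> Nat" "ty \<Gamma> Two" "ty \<Gamma> Empty" "ty \<Gamma> Unit"
  "wt \<Gamma> P (Univ l) \<Longrightarrow> ty \<Gamma> (rosoliniStructure l P)"
  by (simp_all add: arr_def times_def isProp_def isSet_def neg_def ty_formation ty_wk wt_nty
      ty_wt[OF wt_formation(1)] ty_wt[OF wt_formation(2)] ty_wt[OF wt_formation(3)]
      ty_wt[OF wt_formation(4)] ty_wt[OF wt_formation_defs(4)] ty_wt[OF wt_formation_defs(5)]
      ty_wt[OF wt_formation_defs(6)] ty_wt[OF wt_formation_defs(7)]
      rosoliniStructure_def wt_wk_Univ wt_formation_defs inst_def)

lemmas typing = wt_nty wt_wk wt_wk_Univ ty_wk ty_nty wt_formation wt_formation_defs ty_formation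
  ty_formation_defs inst_def inst2_def

section \<open>Introduction and elimination rules for inhabitation\<close>

lemma inh_convert: "\<Gamma> \<tturnstile> A \<Longrightarrow> (\<turnstile> \<Gamma> \<Longrightarrow> \<Gamma> \<turnstile> A \<^bold>\<equiv> B \<^bold>: Univ l) \<Longrightarrow> \<Gamma> \<tturnstile> B"
  by (auto simp: inh_def intro: ty_conv)

lemma inh_nty: "nty \<Gamma> t = Some A \<Longrightarrow> \<Gamma> \<tturnstile> A"
  by (auto simp: inh_def intro: nty_sound)

lemma inh_Pi: "ty \<Gamma> A \<Longrightarrow> A # \<Gamma> \<tturnstile> B \<Longrightarrow> \<Gamma> \<tturnstile> Pi A B"
  by (auto simp: inh_def intro: ty_Lam dest: ctx_Cons)

lemma inh_App: "\<Gamma> \<tturnstile> Pi A B \<Longrightarrow> wt \<Gamma> a A \<Longrightarrow> \<Gamma> \<tturnstile> inst B a"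
  by (auto simp: inh_def wt_def intro: ty_App)

lemma inh_arr: "ty \<Gamma> A \<Longrightarrow> A # \<Gamma> \<tturnstile> wk B \<Longrightarrow> \<Gamma> \<tturnstile> A \<rightarrow>\<^sub>t B"
  by (simp add: arr_def inh_Pi)

lemma inh_mp:
  assumes "\<Gamma> \<tturnstile> A \<rightarrow>\<^sub>t B" "\<Gamma> \<tturnstile> A"
  shows "\<Gamma> \<tturnstile> B"
  using assms ty_App[of \<Gamma> _ A "wk B"] by (fastforce simp: inh_def arr_def)

lemma inh_cut: "ty \<Gamma> A \<Longrightarrow> \<Gamma> \<tturnstile> A \<Longrightarrow> A # \<Gamma> \<tturnstile> wk B \<Longrightarrow> \<Gamma> \<tturnstile> B"
  by (blast intro: inh_mp inh_arr)

lemma inh_Sg: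
  assumes "ty (A # \<Gamma>) B" "wt \<Gamma> a A" "ty \<Gamma> A" "\<Gamma> \<tturnstile> inst B a"
  shows "\<Gamma> \<tturnstile> Sg A B"
  using assms ctx_Cons[of \<Gamma> A] unfolding inh_def wt_def ty_def by (blast intro: ty_Pr)

lemma inh_times:
  assumes "ty \<Gamma> A" "ty \<Gamma> B" "\<Gamma> \<tturnstile> A" "\<Gamma> \<tturnstile> B"
  shows "\<Gamma> \<tturnstile> A \<times>\<^sub>t B"
proof -
  have "ty (A # \<Gamma>) (wk B)" using assms by (simp add: ty_wk)
  then show ?thesis
    using assms ctx_Cons[of \<Gamma> A] unfolding inh_def ty_def times_def
    by (metis inst_wk ty_Pr)
qed

lemma inh_Plus:
  assumes "ty \<Gamma> A" "ty \<Gamma> B"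
  shows "\<Gamma> \<tturnstile> A \<Longrightarrow> \<Gamma> \<tturnstile> Plus A B" "\<Gamma> \<tturnstile> B \<Longrightarrow> \<Gamma> \<tturnstile> Plus A B"
  using assms unfolding inh_def ty_def by (blast intro: ty_InjL ty_InjR)+

lemma inh_Case:
  assumes "ty \<Gamma> A" "ty \<Gamma> B" "ty \<Gamma> C" "\<Gamma> \<tturnstile> Plus A B" "A # \<Gamma> \<tturnstile> wk C" "B # \<Gamma> \<tturnstile> wk C"
  shows "\<Gamma> \<tturnstile> C"
  unfolding inh_def
proof
  assume ctx: "\<turnstile> \<Gamma>"
  have "ty (Plus A B # \<Gamma>) (wk C)" using assms by (simp add: ty_wk)
  then obtain l where C: "Plus A B # \<Gamma> \<turnstile> wk C \<^bold>: Univ l"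
    using ctx ctx_Cons[OF ty_formation(4)[OF assms(1,2)]] unfolding ty_def by blast
  obtain c d t where "A # \<Gamma> \<turnstile> c \<^bold>: wk C" "B # \<Gamma> \<turnstile> d \<^bold>: wk C" "\<Gamma> \<turnstile> t \<^bold>: Plus A B"
    using assms ctx_Cons[OF assms(1) ctx] ctx_Cons[OF assms(2) ctx] ctx unfolding inh_def by blast
  then have "\<Gamma> \<turnstile> Case (wk C) c d t \<^bold>: inst (wk C) t"
    by (intro ty_Case[OF C]) (simp_all add: subst_Var_ren)
  then show "\<exists>t. \<Gamma> \<turnstile> t \<^bold>: C" by auto
qed

lemma inh_Abort: "ty \<Gamma> C \<Longrightarrow> \<Gamma> \<tturnstile> Empty \<Longrightarrow> \<Gamma> \<tturnstile> C"
  using ty_wk[of \<Gamma> C Empty] ctx_Cons[OF ty_formation_defs(12), of \<Gamma>]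
  unfolding inh_def ty_def by (metis inst_wk ty_Abort)

lemma inh_UnitInd:
  assumes "ty (Unit # \<Gamma>) C" "\<Gamma> \<tturnstile> inst C Star" "wt \<Gamma> t Unit"
  shows "\<Gamma> \<tturnstile> inst C t"
  using assms ctx_Cons[OF ty_formation_defs(13), of \<Gamma>]
  unfolding inh_def ty_def wt_def by (blast intro: ty_UnitInd)

lemma inh_TwoInd:
  assumes "ty (Two # \<Gamma>) C" "\<Gamma> \<tturnstile> inst C Zero2" "\<Gamma> \<tturnstile> inst C One2" "wt \<Gamma> t Two"
  shows "\<Gamma> \<tturnstile> inst C t"
  using assms ctx_Cons[OF ty_formation_defs(11), of \<Gamma>]
  unfolding inh_def ty_def wt_def by (blast intro: ty_TwoInd)

lemma inh_Refl: "wt \<Gamma> a A \<Longrightarrow> \<Gamma> \<tturnstile> Idt A a a"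
  unfolding inh_def wt_def by (blast intro: ty_Refl)

lemma inh_J:
  assumes "ty \<Gamma> A" "wt \<Gamma> a A" "wt \<Gamma> b A" "wt \<Gamma> p (Idt A a b)"
    and "ty (Idt (wk A) (wk a) v0 # A # \<Gamma>) C" "\<Gamma> \<tturnstile> inst2 C a (Refl a)"
  shows "\<Gamma> \<tturnstile> inst2 C b p"
proof -
  have "ty (A # \<Gamma>) (Idt (wk A) (wk a) v0)" using assms by (simp add: typing)
  then show ?thesis
    using assms ctx_Cons[of \<Gamma> A] ctx_Cons[of "A # \<Gamma>" "Idt (wk A) (wk a) v0"]
    unfolding inh_def wt_def ty_def by (blast intro: ty_J)
qed

lemma inh_transport:
  assumes "ty \<Gamma> A" "wt \<Gamma> a A" "wt \<Gamma> b A" "\<Gamma> \<tturnstile> Idt A a b"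
    and "ty (A # \<Gamma>) D" "\<Gamma> \<tturnstile> inst D a"
  shows "\<Gamma> \<tturnstile> inst D b"
\<comment> \<open>\<open>inh_J\<close> needs a named path, and inhabitation provides one only in a
  well-formed context; otherwise the claim is vacuous.\<close>
proof (cases "\<turnstile> \<Gamma>")
  case True
  then obtain p where "wt \<Gamma> p (Idt A a b)" using assms unfolding inh_def wt_def by blast
  from inh_J[OF assms(1-3) this, of "wk D"] show ?thesis using assms by (simp add: ty_wk)
qed (simp add: inh_def)

lemma inh_sym:
  assumes "ty \<Gamma> A" "wt \<Gamma> a A" "wt \<Gamma> b A" "\<Gamma> \<tturnstile> Idt A a b"
  shows "\<Gamma> \<tturnstile> Idt A b a"
  using inh_transport[OF assms, of "Idt (wk A) v0 (wk a)"] assms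
  by (simp add: typing inh_Refl)

lemma inh_trans:
  assumes "ty \<Gamma> A" "wt \<Gamma> a A" "wt \<Gamma> b A" "wt \<Gamma> c A" "\<Gamma> \<tturnstile> Idt A a b" "\<Gamma> \<tturnstile> Idt A b c"
  shows "\<Gamma> \<tturnstile> Idt A a c"
  using inh_transport[OF assms(1,3,4,6), of "Idt (wk A) (wk a) v0"] assms
  by (simp add: typing)

lemma inh_Trunc: "\<Gamma> \<tturnstile> A \<Longrightarrow> \<Gamma> \<tturnstile> Trunc A"
  unfolding inh_def by (blast intro: ty_Inc)

lemma inh_isProp:
  "ty \<Gamma> A \<Longrightarrow> wk A # A # \<Gamma> \<tturnstile> Idt (wk (wk A)) v1 v0 \<Longrightarrow> \<Gamma> \<tturnstile> isProp A"
  by (simp add: isProp_def inh_Pi ty_wk)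

lemma isPropD:
  assumes "\<Gamma> \<tturnstile> isProp A" "wt \<Gamma> a A" "wt \<Gamma> b A"
  shows "\<Gamma> \<tturnstile> Idt A a b"
  using inh_App[OF inh_App[OF assms(1)[unfolded isProp_def] assms(2), unfolded inst_def subst.simps],
      of b] assms(3)
  by (simp add: inst_def)

lemma isSetD:
  assumes "\<Gamma> \<tturnstile> isSet A" "wt \<Gamma> a A" "wt \<Gamma> b A"
  shows "\<Gamma> \<tturnstile> isProp (Idt A a b)"
  using inh_App[OF inh_App[OF assms(1)[unfolded isSet_def] assms(2), unfolded inst_def subst.simps],
      of b] assms(3)
  by (simp add: inst_def)

text \<open>Restricting the target to truncations discharges the side condition of the eliminator
  once and for all: \<open>Squash\<close> shows that they are propositions.\<close>

lemma inh_TruncRec: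
  assumes "ty \<Gamma> A" "ty \<Gamma> B" "\<Gamma> \<tturnstile> Trunc A" "A # \<Gamma> \<tturnstile> wk (Trunc B)"
  shows "\<Gamma> \<tturnstile> Trunc B"
proof -
  have "Trunc (wk B) # Trunc B # \<Gamma> \<turnstile> Squash v1 v0 \<^bold>: Idt (Trunc (wk (wk B))) v1 v0"
    if "\<turnstile> Trunc (wk B) # Trunc B # \<Gamma>"
    using that by (intro ty_Squash nty_sound) simp_all
  then have "wk (Trunc B) # Trunc B # \<Gamma> \<tturnstile> Idt (wk (wk (Trunc B))) v1 v0"
    by (auto simp: inh_def)
  then have "\<Gamma> \<tturnstile> isProp (Trunc B)"
    using assms by (intro inh_isProp) (simp add: ty_formation)
  moreover have "\<Gamma> \<tturnstile> A \<rightarrow>\<^sub>t Trunc B" using assms by (simp add: inh_arr)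
  moreover have "ty \<Gamma> (Trunc B)" using assms by (simp add: ty_formation)
  ultimately show ?thesis
    using assms(3) unfolding inh_def ty_def by (blast intro: ty_TruncRec)
qed

lemma inh_Funext:
  assumes "ty \<Gamma> A" "wt \<Gamma> f (Pi A B)" "wt \<Gamma> g (Pi A B)"
    and "A # \<Gamma> \<tturnstile> Idt B (App (wk f) v0) (App (wk g) v0)"
  shows "\<Gamma> \<tturnstile> Idt (Pi A B) f g"
  using inh_Pi[OF assms(1,4)] assms(2,3) unfolding inh_def wt_def by (blast intro: ty_Funext)

lemma inh_Propext:
  assumes "wt \<Gamma> P (Univ l)" "wt \<Gamma> Q (Univ l)" "\<Gamma> \<tturnstile> isProp P" "\<Gamma> \<tturnstile> isProp Q"
    and "\<Gamma> \<tturnstile> P \<rightarrow>\<^sub>t Q" "\<Gamma> \<tturnstile> Q \<rightarrow>\<^sub>t P"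
  shows "\<Gamma> \<tturnstile> Idt (Univ l) P Q"
  using assms unfolding inh_def wt_def by (blast intro: ty_Propext)

section \<open>Propositions and sets\<close>

lemma inh_wk_under:
  assumes "ty \<Gamma> A" "A # \<Gamma> \<tturnstile> C"
  shows "wk A # B # \<Gamma> \<tturnstile> ren (upren Suc) C"
  using assms ctx_Cons[OF assms(1)] ty_weaken_under[of A \<Gamma> _ C B] unfolding inh_def
  by (meson ctx_ConsD(1))

lemma wt_App: "wt \<Gamma> f (Pi A B) \<Longrightarrow> wt \<Gamma> a A \<Longrightarrow> wt \<Gamma> (App f a) (inst B a)"
  by (auto simp: wt_def intro: ty_App)

lemma wt_Lam: "ty \<Gamma> A \<Longrightarrow> wt (A # \<Gamma>) b B \<Longrightarrow> wt \<Gamma> (Lam A b) (Pi A B)"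
  by (auto simp: wt_def intro: ty_Lam dest: ctx_Cons)

text \<open>This says that the identity type is logically equivalent to some proposition of level
  \<open>i\<close>. Being a type of the theory, it can be assumed as a variable, and the proposition
  and both maps are then projections with computable types.\<close>

definition propId :: "nat \<Rightarrow> tm \<Rightarrow> tm \<Rightarrow> tm \<Rightarrow> tm" where
  "propId i A a b = Sg (Univ i)
     (isProp v0 \<times>\<^sub>t (wk (Idt A a b) \<rightarrow>\<^sub>t v0) \<times>\<^sub>t (v0 \<rightarrow>\<^sub>t wk (Idt A a b)))"

lemma propId_simps [simp]:
  "ren r (propId i A a b) = propId i (ren r A) (ren r a) (ren r b)"
  "subst s (propId i A a b) = propId i (subst s A) (subst s a) (subst s b)"
  "dest_Sg (propId i A a b) =
     Some (Univ i, isProp v0 \<times>\<^sub>t (wk (Idt A a b) \<rightarrow>\<^sub>t v0) \<times>\<^sub>t (v0 \<rightarrow>\<^sub>t wk (Idt A a b)))"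
  by (simp_all add: propId_def)

lemma ty_propId: "ty \<Gamma> A \<Longrightarrow> wt \<Gamma> a A \<Longrightarrow> wt \<Gamma> b A \<Longrightarrow> ty \<Gamma> (propId i A a b)"
  by (simp add: propId_def typing)

lemma inh_propId:
  assumes "wt \<Gamma> R (Univ i)" "ty \<Gamma> A" "wt \<Gamma> a A" "wt \<Gamma> b A"
    and "\<Gamma> \<tturnstile> isProp R" "\<Gamma> \<tturnstile> Idt A a b \<rightarrow>\<^sub>t R" "\<Gamma> \<tturnstile> R \<rightarrow>\<^sub>t Idt A a b"
  shows "\<Gamma> \<tturnstile> propId i A a b"
  unfolding propId_def
proof (rule inh_Sg[where a = R])
  have "ty \<Gamma> R" using assms(1) by (rule ty_wt)
  then show "\<Gamma> \<tturnstile> inst (isProp v0 \<times>\<^sub>t (wk (Idt A a b) \<rightarrow>\<^sub>t v0) \<times>\<^sub>t (v0 \<rightarrow>\<^sub>t wk (Idt A a b))) R"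
    using assms by (simp add: typing inh_times)
qed (use assms in \<open>simp_all add: typing\<close>)

text \<open>The map in the first component is \<open>q \<mapsto> e\<inverse> \<bullet> q\<close>.\<close>

lemma inh_transpose:
  assumes "ty \<Gamma> A" "wt \<Gamma> x A" "wt \<Gamma> z A" "wt \<Gamma> e (Idt A x z)"
  shows "\<Gamma> \<tturnstile> Sg (Pi A (Idt (wk A) (wk x) v0 \<rightarrow>\<^sub>t Idt (wk A) (wk z) v0))
    (Idt (Idt (wk A) (wk z) (wk z)) (Refl (wk z)) (App (App v0 (wk z)) (wk e)))"
proof -
  let ?C = "Sg (Pi (wk (wk A)) (Idt (wk (wk (wk A))) (wk (wk (wk x))) v0 \<rightarrow>\<^sub>t
      Idt (wk (wk (wk A))) v2 v0))
    (Idt (Idt (wk (wk (wk A))) v2 v2) (Refl v2) (App (App v0 v2) v1))"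
  let ?I = "Idt (wk A) (wk x) v0"
  let ?T = "Lam A (Lam ?I v0)"
  have C: "ty (Idt (wk A) (wk x) v0 # A # \<Gamma>) ?C"
    using assms by (simp add: typing)
  have I: "ty (A # \<Gamma>) ?I" using assms by (simp add: typing)
  have L: "wt (A # \<Gamma>) (Lam ?I v0) (?I \<rightarrow>\<^sub>t ?I)"
    unfolding arr_def by (rule wt_Lam[OF I]) (simp add: typing)
  have T: "wt \<Gamma> ?T (Pi A (?I \<rightarrow>\<^sub>t ?I))"
    using assms(1) L by (rule wt_Lam)
  \<comment> \<open>When \<open>e\<close> is reflexivity, the identity map \<open>?T\<close> serves
    as first component, and two beta steps make the required equation reflexive.\<close>
  have "\<Gamma> \<turnstile> App (App ?T x) (Refl x) \<^bold>\<equiv> Refl x \<^bold>: Idt A x x" if ctx: "\<turnstile> \<Gamma>"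
  proof -
    have x: "\<Gamma> \<turnstile> x \<^bold>: A" using assms(2) ctx by (simp add: wt_def)
    have "A # \<Gamma> \<turnstile> Lam ?I v0 \<^bold>: (?I \<rightarrow>\<^sub>t ?I)"
      using L ctx_Cons[OF assms(1) ctx] by (simp add: wt_def)
    then have 1: "\<Gamma> \<turnstile> App ?T x \<^bold>\<equiv> Lam (Idt A x x) v0 \<^bold>: Pi (Idt A x x) (wk (Idt A x x))"
      using Pi_beta[OF _ x] by (fastforce simp: inst_def arr_def)
    have r: "\<Gamma> \<turnstile> Refl x \<^bold>: Idt A x x" using x by (rule ty_Refl)
    have "\<turnstile> Idt A x x # \<Gamma>"
      using assms ctx by (intro ctx_Cons) (simp_all add: typing)
    then have "Idt A x x # \<Gamma> \<turnstile> v0 \<^bold>: wk (Idt A x x)" by (intro nty_sound) simp_all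
    from Pi_beta[OF this r] have "\<Gamma> \<turnstile> App (Lam (Idt A x x) v0) (Refl x) \<^bold>\<equiv> Refl x \<^bold>: Idt A x x"
      by (simp add: inst_def)
    with eq_App[OF 1 eq_refl[OF r]] show ?thesis by (auto simp: inst_def intro: eq_trans)
  qed
  then have beta: "\<Gamma> \<tturnstile> Idt (Idt A x x) (Refl x) (App (App ?T x) (Refl x))"
    using assms unfolding inh_def wt_def
    by (meson eq_refl eq_sym ty_Idt ty_Refl ty_conv ty_def eq_Idt)
  have r: "wt \<Delta> (Refl y) (Idt B y y)" if "wt \<Delta> y B" for \<Delta> y B
    using that by (auto simp: wt_def intro: ty_Refl)
  let ?\<Delta> = "Pi A (?I \<rightarrow>\<^sub>t ?I) # \<Gamma>"
  have "wt ?\<Delta> (App v0 (wk x)) (Pi (Idt (wk A) (wk x) (wk x)) (wk (Idt (wk A) (wk x) (wk x))))"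
    using wt_App[of ?\<Delta> v0 "wk A" "Idt (wk (wk A)) (wk (wk x)) v0 \<rightarrow>\<^sub>t Idt (wk (wk A)) (wk (wk x)) v0"
        "wk x"] assms by (simp add: typing arr_def)
  then have "wt ?\<Delta> (App (App v0 (wk x)) (Refl (wk x))) (Idt (wk A) (wk x) (wk x))"
    using wt_App[of ?\<Delta> "App v0 (wk x)" "Idt (wk A) (wk x) (wk x)" "wk (Idt (wk A) (wk x) (wk x))"
        "Refl (wk x)"] r[of ?\<Delta>] assms by (simp add: typing)
  then have base: "\<Gamma> \<tturnstile> inst2 ?C x (Refl x)"
    using r[of ?\<Delta>] inh_Sg[OF _ T, of
      "Idt (Idt (wk A) (wk x) (wk x)) (Refl (wk x)) (App (App v0 (wk x)) (Refl (wk x)))"]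
      assms beta by (simp add: typing)
  from inh_J[OF assms C base] show ?thesis by (simp add: typing)
qed

text \<open>
  Hedberg's argument: if \<open>g\<close> is the composite of \<open>x = y\<close> with the proposition and back, then path
  induction gives \<open>p = (g refl)\<inverse> \<bullet> g p\<close>, and \<open>g\<close> is constant.
\<close>

lemma isSet_of_propId:
  assumes "ty \<Gamma> A" "\<Gamma> \<tturnstile> Pi A (Pi (wk A) (propId i (wk (wk A)) v1 v0))"
  shows "\<Gamma> \<tturnstile> isSet A"
proof -
  let ?G = "Pi A (Pi (wk A) (propId i (wk (wk A)) v1 v0))"
  let ?to = "\<lambda>G x y. Fst (Snd (Snd (App (App G x) y)))"
  let ?from = "\<lambda>G x y. Snd (Snd (Snd (App (App G x) y)))"
  let ?S = "Sg (Pi (wk (wk A)) (Idt (wk (wk (wk A))) v1 v0 \<rightarrow>\<^sub>t Idt (wk (wk (wk A))) v1 v0))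
    (Idt (Idt (wk (wk (wk A))) v1 v1) (Refl v1)
      (App (App v0 v1) (App (?from v2 v1 v1) (App (?to v2 v1 v1) (Refl v1)))))"
  let ?K = "Pi (wk (wk (wk A))) (Pi (Idt (wk (wk (wk (wk A)))) v2 v0)
    (Idt (Idt (wk (wk (wk (wk (wk A))))) v3 v1) v0
      (App (App (Fst v2) v1) (App (?from v4 v3 v1) (App (?to v4 v3 v1) v0)))))"
  \<comment> \<open>In this context \<open>v6\<close> is the family of propositions,
    \<open>v5\<close> the common starting point, \<open>v4\<close> the transposing map with its
    equation, \<open>v3\<close> the representation of all paths through g, \<open>v2\<close> the
    endpoint, and \<open>v1\<close>, \<open>v0\<close> are the two paths to be identified.\<close>
  let ?\<Delta> = "Idt (wk (wk (wk (wk (wk (wk A)))))) v4 v1 # Idt (wk (wk (wk (wk (wk A))))) v3 v0 #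
    wk (wk (wk (wk A))) # ?K # ?S # wk A # ?G # \<Gamma>"
  note [simp] = typing ty_propId
  \<comment> \<open>The loop that is transposed is g refl, the round trip of reflexivity through the
    proposition.\<close>
  have S: "wk A # ?G # \<Gamma> \<tturnstile> ?S"
    using assms inh_transpose[of "wk A # ?G # \<Gamma>" "wk (wk A)" v0 v0
      "App (?from v1 v0 v0) (App (?to v1 v0 v0) (Refl v0))"] by simp
  \<comment> \<open>At reflexivity the equation is the second component of
    \<open>?S\<close>.\<close>
  have K: "?S # wk A # ?G # \<Gamma> \<tturnstile> ?K"
  proof (intro inh_Pi)
    let ?C = "Idt (Idt (wk (wk (wk (wk (wk (wk (wk A))))))) v5 v1) v0
      (App (App (Fst v4) v1) (App (?from v6 v5 v1) (App (?to v6 v5 v1) v0)))"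
    let ?\<Gamma> = "Idt (wk (wk (wk (wk A)))) v2 v0 # wk (wk (wk A)) # ?S # wk A # ?G # \<Gamma>"
    show "?\<Gamma> \<tturnstile> Idt (Idt (wk (wk (wk (wk (wk A))))) v3 v1) v0
      (App (App (Fst v2) v1) (App (?from v4 v3 v1) (App (?to v4 v3 v1) v0)))"
      using assms inh_J[of ?\<Gamma> "wk (wk (wk (wk (wk A))))" v3 v1 v0 ?C] inh_nty[of ?\<Gamma> "Snd v2"]
      by simp
  qed (use assms in simp_all)
  have h1: "?\<Delta> \<tturnstile> Idt (Idt (wk (wk (wk (wk (wk (wk (wk A))))))) v5 v2) v1
      (App (App (Fst v4) v2) (App (?from v6 v5 v2) (App (?to v6 v5 v2) v1)))"
    using inh_nty[of ?\<Delta> "App (App v3 v2) v1"] by simp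
  have h2: "?\<Delta> \<tturnstile> Idt (Idt (wk (wk (wk (wk (wk (wk (wk A))))))) v5 v2) v0
      (App (App (Fst v4) v2) (App (?from v6 v5 v2) (App (?to v6 v5 v2) v0)))"
    using inh_nty[of ?\<Delta> "App (App v3 v2) v0"] by simp
  \<comment> \<open>Constancy of g: both paths have equal images in the proposition, and
    \<open>h3\<close> transports along that equality.\<close>
  have "?\<Delta> \<tturnstile> Idt (Fst (App (App v6 v5) v2)) (App (?to v6 v5 v2) v1) (App (?to v6 v5 v2) v0)"
    using assms by (intro isPropD inh_nty[of _ "Fst (Snd (App (App v6 v5) v2))"]) simp_all
  then have h3: "?\<Delta> \<tturnstile> Idt (Idt (wk (wk (wk (wk (wk (wk (wk A))))))) v5 v2)
      (App (App (Fst v4) v2) (App (?from v6 v5 v2) (App (?to v6 v5 v2) v1)))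
      (App (App (Fst v4) v2) (App (?from v6 v5 v2) (App (?to v6 v5 v2) v0)))"
    using inh_transport[of ?\<Delta> "Fst (App (App v6 v5) v2)" "App (?to v6 v5 v2) v1"
      "App (?to v6 v5 v2) v0" "Idt (Idt (wk (wk (wk (wk (wk (wk (wk (wk A)))))))) v6 v3)
      (App (App (Fst v5) v3) (App (?from v7 v6 v3) (App (?to v7 v6 v3) v2)))
      (App (App (Fst v5) v3) (App (?from v7 v6 v3) v0))"] assms
    by (simp add: inh_Refl)
  have "?\<Delta> \<tturnstile> Idt (Idt (wk (wk (wk (wk (wk (wk (wk A))))))) v5 v2) v1 v0"
    by (rule inh_trans[OF _ _ _ _ h1], rule_tac[5] inh_trans[OF _ _ _ _ h3],
        rule_tac[9] inh_sym[OF _ _ _ h2])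
      (use assms in simp_all)
  then have "?K # ?S # wk A # ?G # \<Gamma> \<tturnstile>
      Pi (wk (wk (wk (wk A)))) (isProp (Idt (wk (wk (wk (wk (wk A))))) v3 v0))"
    using assms by (intro inh_Pi inh_isProp) simp_all
  with K have "?S # wk A # ?G # \<Gamma> \<tturnstile> Pi (wk (wk (wk A))) (isProp (Idt (wk (wk (wk (wk A)))) v2 v0))"
    using assms by - (rule inh_cut[of _ ?K]; simp)
  with S have "wk A # ?G # \<Gamma> \<tturnstile> Pi (wk (wk A)) (isProp (Idt (wk (wk (wk A))) v1 v0))"
    using assms by - (rule inh_cut[of _ ?S]; simp)
  then have "?G # \<Gamma> \<tturnstile> isSet (wk A)"
    using assms unfolding isSet_def by - (rule inh_Pi; simp)
  with assms show ?thesis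
    by - (rule inh_cut[of _ ?G]; simp)
qed

text \<open>For two elements of \<open>X\<close>, their identity type and \<open>X\<close> are both
  inhabited, so \<open>X\<close> itself is the proposition required by Hedberg's argument.\<close>

lemma isSet_of_isProp:
  assumes "wt \<Gamma> X (Univ i)" "\<Gamma> \<tturnstile> isProp X"
  shows "\<Gamma> \<tturnstile> isSet X"
proof -
  let ?\<Delta> = "wk X # X # \<Gamma>"
  have X: "ty \<Gamma> X" using assms(1) by (rule ty_wt)
  have h: "?\<Delta> \<tturnstile> isProp (wk (wk X))"
    using inh_wk[OF inh_wk[OF assms(2)], of "wk X" X] by simp
  then have "?\<Delta> \<tturnstile> Idt (wk (wk X)) v1 v0" by (intro isPropD) (simp_all add: typing)
  then have "?\<Delta> \<tturnstile> wk (wk X) \<rightarrow>\<^sub>t Idt (wk (wk X)) v1 v0"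
    using X by (intro inh_arr inh_wk) (simp_all add: typing)
  moreover have "?\<Delta> \<tturnstile> Idt (wk (wk X)) v1 v0 \<rightarrow>\<^sub>t wk (wk X)"
    using X by (intro inh_arr inh_nty[of _ v1]) (simp_all add: typing)
  ultimately have "?\<Delta> \<tturnstile> propId i (wk (wk X)) v1 v0"
    using h X assms by (intro inh_propId) (simp_all add: typing)
  then show ?thesis using X by (intro isSet_of_propId inh_Pi) (simp_all add: typing)
qed

section \<open>Closure properties of propositions\<close>

lemma isProp_Pi:
  assumes "ty \<Gamma> A" "ty (A # \<Gamma>) B" "A # \<Gamma> \<tturnstile> isProp B"
  shows "\<Gamma> \<tturnstile> isProp (Pi A B)"
proof -
  let ?\<Delta> = "wk (wk A) # wk (Pi A B) # Pi A B # \<Gamma>"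
  let ?B = "ren (upren Suc) (ren (upren Suc) B)"
  have "?\<Delta> \<tturnstile> isProp ?B"
    using inh_wk_under[OF _ inh_wk_under[OF assms(1,3)], of "Pi A B" "wk (Pi A B)"] assms
    by (simp add: typing)
  then have "?\<Delta> \<tturnstile> Idt ?B (App v2 v0) (App v1 v0)"
    by (rule isPropD) (simp_all add: typing)
  then show ?thesis using assms
    by (intro inh_isProp) (simp_all add: typing inh_Funext)
qed

lemma isProp_arr:
  assumes "ty \<Gamma> A" "ty \<Gamma> B" "\<Gamma> \<tturnstile> isProp B"
  shows "\<Gamma> \<tturnstile> isProp (A \<rightarrow>\<^sub>t B)"
  using isProp_Pi[of \<Gamma> A "wk B"] assms inh_wk[OF assms(3), of A] by (simp add: arr_def typing)

text \<open>Comparing two elements already presupposes one. This matters where propositionality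
  depends on data carried by the elements.\<close>

lemma isProp_self:
  assumes "ty \<Gamma> A" "A # \<Gamma> \<tturnstile> isProp (wk A)"
  shows "\<Gamma> \<tturnstile> isProp A"
proof (rule inh_isProp[OF assms(1)])
  have "wk A # A # \<Gamma> \<tturnstile> isProp (wk (wk A))"
    using inh_wk[OF assms(2), of "wk A"] by simp
  then show "wk A # A # \<Gamma> \<tturnstile> Idt (wk (wk A)) v1 v0"
    by (rule isPropD) (simp_all add: typing)
qed

text \<open>An element of \<open>isProp X\<close> makes \<open>X\<close> a set, and then
  \<open>isProp X\<close> is an iterated product of identity types that are propositions.\<close>

lemma isProp_isProp:
  assumes X: "wt \<Gamma> X (Univ i)"
  shows "\<Gamma> \<tturnstile> isProp (isProp X)"
proof (rule isProp_self)
  let ?\<Gamma> = "isProp X # \<Gamma>" and ?\<Delta> = "wk (wk X) # wk X # isProp X # \<Gamma>"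
  have X': "wt ?\<Gamma> (wk X) (Univ i)" using X by (simp add: typing)
  then have ty: "ty \<Gamma> X" "ty ?\<Gamma> (wk X)" using X by (simp_all add: ty_wt)
  show "ty \<Gamma> (isProp X)" using ty by (simp add: typing)
  have "?\<Gamma> \<tturnstile> isSet (wk X)"
    by (rule isSet_of_isProp[OF X'], rule inh_nty[of _ v0]) simp
  then have "?\<Delta> \<tturnstile> isSet (wk (wk (wk X)))"
    using inh_wk[OF inh_wk, of ?\<Gamma> "isSet (wk X)" "wk (wk X)" "wk X"] by simp
  then have "?\<Delta> \<tturnstile> isProp (Idt (wk (wk (wk X))) v1 v0)"
    by (rule isSetD) (simp_all add: typing)
  then show "?\<Gamma> \<tturnstile> isProp (wk (isProp X))"
    using ty unfolding ren_defs unfolding isProp_def[of "wk X"]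
    by (intro isProp_Pi) (simp_all add: typing)
qed

section \<open>Identity types of dependent sums\<close>

lemma ty_wk_under:
  assumes "ty \<Gamma> A" "ty (A # \<Gamma>) C"
  shows "ty (wk A # B # \<Gamma>) (ren (upren Suc) C)"
  using assms ctx_Cons[OF assms(1)] ty_weaken_under[of A \<Gamma> C "Univ _" B] unfolding ty_def
  by (metis ctx_ConsD(1) ren.simps(2))

lemma inh_inst: "ty \<Gamma> A \<Longrightarrow> A # \<Gamma> \<tturnstile> C \<Longrightarrow> wt \<Gamma> a A \<Longrightarrow> \<Gamma> \<tturnstile> inst C a"
  by (blast intro: inh_App inh_Pi)

lemma ty_of_inst:
  assumes "ty \<Gamma> A" "ty (A # \<Gamma>) C" "wt \<Gamma> a A"
  shows "ty \<Gamma> (inst C a)"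
  using assms ctx_Cons[OF assms(1)] ty_inst[of A \<Gamma> C "Univ _" a] unfolding wt_def ty_def
  by (fastforce simp: inst_def)

lemma wt_Pr:
  assumes "ty \<Gamma> A" "ty (A # \<Gamma>) B" "wt \<Gamma> a A" "wt \<Gamma> b (inst B a)"
  shows "wt \<Gamma> (Pr a b) (Sg A B)"
  using assms ctx_Cons[OF assms(1)] unfolding wt_def ty_def by (blast intro: ty_Pr)

lemma inh_ap_Pr:
  assumes A: "ty \<Gamma> A" and B: "ty (A # \<Gamma>) B" and a: "wt \<Gamma> a A"
    and b: "wt \<Gamma> b (inst B a)" "wt \<Gamma> b' (inst B a)" and eq: "\<Gamma> \<tturnstile> Idt (inst B a) b b'"
  shows "\<Gamma> \<tturnstile> Idt (Sg A B) (Pr a b) (Pr a b')"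
proof -
  let ?D = "Idt (wk (Sg A B)) (wk (Pr a b)) (Pr (wk a) v0)"
  have Ba: "ty \<Gamma> (inst B a)" using A B a by (rule ty_of_inst)
  have "wt (inst B a # \<Gamma>) (Pr (wk a) v0) (Sg (wk A) (ren (upren Suc) B))"
    using A B a by (intro wt_Pr ty_wk_under) (simp_all add: ty_wk wt_wk wt_nty ren_inst)
  then have "ty (inst B a # \<Gamma>) ?D"
    using A B wt_wk[OF wt_Pr[OF A B a b(1)]] by (simp add: ty_formation ty_wk ty_wk_under)
  from inh_transport[OF Ba b eq this] show ?thesis
    using wt_Pr[OF A B a b(1)] by (simp add: inst_def inh_Refl)
qed

text \<open>The subtype principle: after transport along the path of first components, the second
  components lie in one and the same proposition.\<close>

lemma inh_Idt_Sg:
  assumes A: "ty \<Gamma> A" and B: "ty (A # \<Gamma>) B" "A # \<Gamma> \<tturnstile> isProp B"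
    and s: "wt \<Gamma> s (Sg A B)" and t: "wt \<Gamma> t (Sg A B)"
    and eq: "\<Gamma> \<tturnstile> Idt A (Fst s) (Fst t)"
  shows "\<Gamma> \<tturnstile> Idt (Sg A B) s t"
proof -
  have SgAB: "ty \<Gamma> (Sg A B)" using A B by (simp add: typing)
  have comp: "wt \<Gamma> (Fst u) A" "wt \<Gamma> (Snd u) (inst B (Fst u))" if "wt \<Gamma> u (Sg A B)" for u
    using that by (auto simp: wt_def intro: ty_Fst ty_Snd)
  define a b where "a = Fst s" and "b = Snd s"
  have a: "wt \<Gamma> a A" and b: "wt \<Gamma> b (inst B a)"
    using comp[OF s] by (simp_all add: a_def b_def)
  have Ba: "ty \<Gamma> (inst B a)" using A B(1) a by (rule ty_of_inst)
  have "wk B = inst (ren (upren Suc) (ren (upren Suc) B)) v1"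
    using ren_inst[of Suc "ren (upren Suc) B" v0] by (simp add: inst_def)
  then have var: "wt (B # A # \<Gamma>) (Pr v1 v0) (Sg (wk (wk A)) (ren (upren Suc) (ren (upren Suc) B)))"
    using A B by (intro wt_Pr ty_wk_under) (simp_all add: ty_wk wt_nty)
  \<comment> \<open>Since \<open>Snd t\<close> has a type over \<open>Fst t\<close>, it cannot occur
    in a motive over a varying first component; the motive quantifies over all second components and
    is applied to \<open>Snd t\<close> at the end.\<close>
  let ?D = "Pi B (Idt (wk (wk (Sg A B))) (wk (wk (Pr a b))) (Pr v1 v0))"
  have "\<Gamma> \<tturnstile> inst ?D (Fst t)"
  proof (rule inh_transport[OF A a])
    show "wt \<Gamma> (Fst t) A" using comp t by simp
    show "\<Gamma> \<tturnstile> Idt A a (Fst t)" using eq by (simp add: a_def)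
    show "ty (A # \<Gamma>) ?D"
      using A B(1) wt_wk[OF wt_wk[OF wt_Pr[OF A B(1) a b]], of B A] var
      by (simp add: ty_formation ty_wk ty_wk_under)
    have "inst B a # \<Gamma> \<tturnstile> isProp (wk (inst B a))"
      using inh_wk[OF inh_inst[OF A B(2) a], of "inst B a"] by (simp add: inst_def)
    then have "inst B a # \<Gamma> \<tturnstile> Idt (wk (inst B a)) (wk b) v0"
      using b by (intro isPropD) (simp_all add: wt_wk wt_nty)
    then have "inst B a # \<Gamma> \<tturnstile> Idt (Sg (wk A) (ren (upren Suc) B)) (Pr (wk a) (wk b)) (Pr (wk a) v0)"
      using A B(1) a wt_wk[OF b, of "inst B a"]
      by (intro inh_ap_Pr ty_wk_under) (simp_all add: ty_wk wt_wk wt_nty ren_inst)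
    then show "\<Gamma> \<tturnstile> inst ?D a"
      using inh_Pi[OF Ba] by (simp add: inst_def)
  qed
  then have "\<Gamma> \<tturnstile> Pi (inst B (Fst t)) (Idt (wk (Sg A B)) (wk (Pr a b)) (Pr (wk (Fst t)) v0))"
    by (simp add: inst_def)
  from inh_App[OF this comp(2)[OF t]]
  have "\<Gamma> \<tturnstile> Idt (Sg A B) (Pr (Fst s) (Snd s)) (Pr (Fst t) (Snd t))"
    by (simp add: inst_def a_def b_def)
  \<comment> \<open>Eta for dependent sums turns the pairs of projections back into \<open>s\<close>
    and \<open>t\<close>.\<close>
  moreover have "\<exists>l. \<Gamma> \<turnstile> Idt (Sg A B) (Pr (Fst s) (Snd s)) (Pr (Fst t) (Snd t)) \<^bold>\<equiv> Idt (Sg A B) s t \<^bold>: Univ l"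
    if "\<turnstile> \<Gamma>"
    using that s t SgAB unfolding wt_def ty_def by (blast intro: eq_Idt eq_refl Sg_eta)
  ultimately show ?thesis unfolding inh_def by (blast intro: ty_conv)
qed

lemma isProp_times:
  assumes "ty \<Gamma> A" "ty \<Gamma> B" "\<Gamma> \<tturnstile> isProp A" "\<Gamma> \<tturnstile> isProp B"
  shows "\<Gamma> \<tturnstile> isProp (A \<times>\<^sub>t B)"
proof (rule inh_isProp)
  let ?\<Delta> = "wk (A \<times>\<^sub>t B) # (A \<times>\<^sub>t B) # \<Gamma>"
  show "ty \<Gamma> (A \<times>\<^sub>t B)" using assms by (simp add: typing)
  have "?\<Delta> \<tturnstile> isProp (wk (wk A))"
    using inh_wk[OF inh_wk[OF assms(3)]] by simp
  then have "?\<Delta> \<tturnstile> Idt (wk (wk A)) (Fst v1) (Fst v0)"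
    by (rule isPropD) (simp_all add: typing)
  moreover have "wk (wk A) # ?\<Delta> \<tturnstile> isProp (wk (wk (wk B)))"
    using inh_wk[OF inh_wk[OF inh_wk[OF assms(4)]]] by simp
  ultimately show "?\<Delta> \<tturnstile> Idt (wk (wk (A \<times>\<^sub>t B))) v1 v0"
    using inh_Idt_Sg[of ?\<Delta> "wk (wk A)" "wk (wk (wk B))" v1 v0] assms
    by (simp add: typing times_def)
qed

section \<open>The types \<open>Unit\<close>, \<open>Empty\<close> and \<open>Two\<close>\<close>

lemma isProp_Unit: "\<Gamma> \<tturnstile> isProp Unit"
proof (rule inh_isProp)
  let ?\<Delta> = "Unit # Unit # \<Gamma>"
  have "?\<Delta> \<tturnstile> Idt Unit Star v0"
    using inh_UnitInd[of ?\<Delta> "Idt Unit Star v0" v0] by (simp add: typing inh_Refl)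
  then show "wk Unit # Unit # \<Gamma> \<tturnstile> Idt (wk (wk Unit)) v1 v0"
    using inh_UnitInd[of ?\<Delta> "Idt Unit v0 v1" v1] by (simp add: typing)
qed (simp add: typing)

lemma isProp_Empty: "\<Gamma> \<tturnstile> isProp Empty"
proof (rule inh_isProp)
  show "wk Empty # Empty # \<Gamma> \<tturnstile> Idt (wk (wk Empty)) v1 v0"
    by (rule inh_Abort) (simp_all add: typing inh_nty[of _ v0])
qed (simp add: typing)

text \<open>Large elimination: transport in the family \<open>?C\<close>, which is
  \<open>Unit\<close> at \<open>Zero2\<close> and \<open>Empty\<close> at \<open>One2\<close>, would
  carry \<open>Star\<close> into \<open>Empty\<close>.\<close>

lemma Zero2_neq_One2: "\<Gamma> \<tturnstile> neg (Idt Two Zero2 One2)"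
proof -
  let ?C = "TwoInd (Univ 0) Unit Empty v0"
  let ?\<Delta> = "Idt Two Zero2 One2 # \<Gamma>"
  have C: "ty (Two # \<Delta>) ?C" for \<Delta>
  proof -
    have "Two # \<Delta> \<turnstile> ?C \<^bold>: inst (Univ 0) v0" if "\<turnstile> Two # \<Delta>"
    proof (rule ty_TwoInd)
      have "\<turnstile> Two # Two # \<Delta>" using that by (rule ctx_Cons[rotated]) (simp add: typing)
      then show "Two # Two # \<Delta> \<turnstile> Univ 0 \<^bold>: Univ 1" using ty_univ[of _ 0] by simp
    qed (use that in \<open>auto simp: inst_def intro: ty_Unit ty_Empty nty_sound\<close>)
    then show ?thesis by (auto simp: ty_def inst_def)
  qed
  have conv: "\<Delta> \<turnstile> inst ?C Zero2 \<^bold>\<equiv> Unit \<^bold>: Univ 0" "\<Delta> \<turnstile> inst ?C One2 \<^bold>\<equiv> Empty \<^bold>: Univ 0"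
    if "\<turnstile> \<Delta>" for \<Delta>
  proof -
    have "\<turnstile> Two # \<Delta>" using that by (intro ctx_Cons) (simp_all add: typing)
    then have U: "Two # \<Delta> \<turnstile> Univ 0 \<^bold>: Univ 1" using ty_univ[of _ 0] by simp
    have b: "\<Delta> \<turnstile> Unit \<^bold>: inst (Univ 0) Zero2" "\<Delta> \<turnstile> Empty \<^bold>: inst (Univ 0) One2"
      using that by (simp_all add: inst_def ty_Unit ty_Empty)
    show "\<Delta> \<turnstile> inst ?C Zero2 \<^bold>\<equiv> Unit \<^bold>: Univ 0" "\<Delta> \<turnstile> inst ?C One2 \<^bold>\<equiv> Empty \<^bold>: Univ 0"
      using Zero2_beta[OF U b] One2_beta[OF U b] by (simp_all add: inst_def)
  qed
  have "?\<Delta> \<tturnstile> Unit" by (rule inh_nty[of _ Star]) simp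
  then have "?\<Delta> \<tturnstile> inst ?C Zero2"
    by (rule inh_convert) (blast intro: eq_sym conv)
  then have "?\<Delta> \<tturnstile> inst ?C One2"
    by (rule inh_transport[OF _ _ _ _ C, rotated 4]) (simp_all add: typing inh_nty[of _ v0])
  then have "?\<Delta> \<tturnstile> Empty"
    by (rule inh_convert) (rule conv)
  then show ?thesis unfolding neg_def by (intro inh_arr) (simp_all add: typing)
qed

text \<open>A decided identity type is equivalent to a known proposition: \<open>Unit\<close> here,
  and \<open>Empty\<close> in the refuted case below.\<close>

lemma propId_of_inh:
  assumes "ty \<Gamma> A" "wt \<Gamma> a A" "wt \<Gamma> b A" "\<Gamma> \<tturnstile> Idt A a b"
  shows "\<Gamma> \<tturnstile> propId i A a b"
proof (rule inh_propId)
  show "\<Gamma> \<tturnstile> Idt A a b \<rightarrow>\<^sub>t Unit"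
    using assms by (intro inh_arr inh_nty[of _ Star]) (simp_all add: typing)
  show "\<Gamma> \<tturnstile> Unit \<rightarrow>\<^sub>t Idt A a b"
    using assms by (intro inh_arr inh_wk) (simp_all add: typing)
qed (use assms in \<open>simp_all add: typing isProp_Unit\<close>)

lemma propId_of_neg:
  assumes "ty \<Gamma> A" "wt \<Gamma> a A" "wt \<Gamma> b A" "\<Gamma> \<tturnstile> neg (Idt A a b)"
  shows "\<Gamma> \<tturnstile> propId i A a b"
proof (rule inh_propId)
  show "\<Gamma> \<tturnstile> Idt A a b \<rightarrow>\<^sub>t Empty"
    using assms by (simp add: neg_def)
  show "\<Gamma> \<tturnstile> Empty \<rightarrow>\<^sub>t Idt A a b"
    by (rule inh_arr, simp add: typing, rule inh_Abort)
      (use assms in \<open>simp_all add: typing inh_nty[of _ v0]\<close>)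
qed (use assms in \<open>simp_all add: typing isProp_Empty\<close>)

text \<open>Identity of bits is decided in each of the four cases of a double induction, so
  Hedberg's argument applies.\<close>

lemma isSet_Two: "\<Gamma> \<tturnstile> isSet Two"
proof (intro isSet_of_propId inh_Pi)
  let ?\<Delta> = "Two # Two # \<Gamma>"
  have eq: "?\<Delta> \<tturnstile> propId 0 Two Zero2 Zero2" "?\<Delta> \<tturnstile> propId 0 Two One2 One2"
    by (simp_all add: propId_of_inh typing inh_Refl)
  have neq: "?\<Delta> \<tturnstile> propId 0 Two Zero2 One2"
    by (simp add: propId_of_neg typing Zero2_neq_One2)
  have "Idt Two One2 Zero2 # ?\<Delta> \<tturnstile> Idt Two Zero2 One2"
    by (rule inh_sym) (simp_all add: typing inh_nty[of _ v0])
  then have "?\<Delta> \<tturnstile> neg (Idt Two One2 Zero2)"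
    unfolding neg_def using Zero2_neq_One2[unfolded neg_def]
    by (intro inh_arr) (auto simp: typing intro: inh_mp)
  then have neq': "?\<Delta> \<tturnstile> propId 0 Two One2 Zero2"
    by (simp add: propId_of_neg typing)
  have "?\<Delta> \<tturnstile> propId 0 Two Zero2 v0"
    using inh_TwoInd[of ?\<Delta> "propId 0 Two Zero2 v0" v0] eq neq by (simp add: typing ty_propId)
  moreover have "?\<Delta> \<tturnstile> propId 0 Two One2 v0"
    using inh_TwoInd[of ?\<Delta> "propId 0 Two One2 v0" v0] eq neq' by (simp add: typing ty_propId)
  ultimately show "wk Two # Two # \<Gamma> \<tturnstile> propId 0 (wk (wk Two)) v1 v0"
    using inh_TwoInd[of ?\<Delta> "propId 0 Two v0 v1" v1] by (simp add: typing ty_propId)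
qed (simp_all add: typing)

section \<open>Small Rosolini structures\<close>

lemma trunc_map: "ty \<Gamma> A \<Longrightarrow> ty \<Gamma> B \<Longrightarrow> \<Gamma> \<tturnstile> Trunc A \<Longrightarrow> \<Gamma> \<tturnstile> A \<rightarrow>\<^sub>t B \<Longrightarrow> \<Gamma> \<tturnstile> Trunc B"
  using inh_mp[OF inh_wk[of \<Gamma> "A \<rightarrow>\<^sub>t B" A, simplified]] inh_TruncRec[of \<Gamma> A B]
  by (simp add: inh_Trunc inh_nty[of _ v0])

text \<open>Evaluation at the given element of \<open>A\<close> yields an element of
  \<open>B\<close> up to truncation, and the constant map with that value is chosen.\<close>

lemma trunc_arr_of_inh:
  assumes "ty \<Gamma> A" "ty \<Gamma> B" "\<Gamma> \<tturnstile> A" "\<Gamma> \<tturnstile> A \<rightarrow>\<^sub>t Trunc B"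
  shows "\<Gamma> \<tturnstile> Trunc (A \<rightarrow>\<^sub>t B)"
proof (rule trunc_map[of _ B])
  show "\<Gamma> \<tturnstile> Trunc B" using assms(3,4) by (blast intro: inh_mp)
  have "wk A # B # \<Gamma> \<tturnstile> wk (wk B)" by (rule inh_nty[of _ v1]) simp
  then show "\<Gamma> \<tturnstile> B \<rightarrow>\<^sub>t (A \<rightarrow>\<^sub>t B)" using assms by (simp add: inh_arr typing)
qed (use assms in \<open>simp_all add: typing\<close>)

lemma trunc_arr_of_neg:
  assumes "ty \<Gamma> A" "ty \<Gamma> B" "\<Gamma> \<tturnstile> neg A"
  shows "\<Gamma> \<tturnstile> Trunc (A \<rightarrow>\<^sub>t B)"
proof -
  have "A # \<Gamma> \<tturnstile> Empty"
    using inh_mp[OF inh_wk[OF assms(3), of A, simplified neg_def ren_defs]] by (simp add: inh_nty[of _ v0])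
  then show ?thesis using assms by (simp add: inh_Trunc inh_arr inh_Abort typing)
qed

lemma inh_compose: "ty \<Gamma> A \<Longrightarrow> \<Gamma> \<tturnstile> A \<rightarrow>\<^sub>t B \<Longrightarrow> \<Gamma> \<tturnstile> B \<rightarrow>\<^sub>t C \<Longrightarrow> \<Gamma> \<tturnstile> A \<rightarrow>\<^sub>t C"
  using inh_mp[OF inh_wk[of \<Gamma> "A \<rightarrow>\<^sub>t B" A, simplified]] inh_mp[OF inh_wk[of \<Gamma> "B \<rightarrow>\<^sub>t C" A, simplified]]
  by (simp add: inh_arr inh_nty[of _ v0])

lemma trunc_map_fun:
  assumes "ty \<Gamma> A" "ty \<Gamma> B" "\<Gamma> \<tturnstile> A \<rightarrow>\<^sub>t B"
  shows "\<Gamma> \<tturnstile> Trunc A \<rightarrow>\<^sub>t Trunc B"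
proof (rule inh_arr)
  have "Trunc A # \<Gamma> \<tturnstile> Trunc (wk B)"
    by (rule trunc_map[of _ "wk A"])
      (use assms inh_wk[OF assms(3), of "Trunc A"] in \<open>simp_all add: typing inh_nty[of _ v0]\<close>)
  then show "Trunc A # \<Gamma> \<tturnstile> wk (Trunc B)" by simp
qed (use assms in \<open>simp add: typing\<close>)

lemma inh_coe:
  assumes "wt \<Gamma> P (Univ l)" "wt \<Gamma> Q (Univ l)" "\<Gamma> \<tturnstile> Idt (Univ l) P Q"
  shows "\<Gamma> \<tturnstile> P \<rightarrow>\<^sub>t Q" "\<Gamma> \<tturnstile> Q \<rightarrow>\<^sub>t P" "\<Gamma> \<tturnstile> isProp Q \<Longrightarrow> \<Gamma> \<tturnstile> isProp P"
proof -
  have ty: "ty \<Gamma> P" "ty \<Gamma> Q" using assms by (simp_all add: ty_wt)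
  have coe: "\<Gamma> \<tturnstile> P \<rightarrow>\<^sub>t P" using ty by (simp add: inh_arr inh_nty[of _ v0])
  show "\<Gamma> \<tturnstile> P \<rightarrow>\<^sub>t Q"
    using inh_transport[OF _ assms, of "wk P \<rightarrow>\<^sub>t v0"] ty coe by (simp add: typing)
  show "\<Gamma> \<tturnstile> Q \<rightarrow>\<^sub>t P"
    using inh_transport[OF _ assms, of "v0 \<rightarrow>\<^sub>t wk P"] ty coe by (simp add: typing)
  show "\<Gamma> \<tturnstile> isProp P" if "\<Gamma> \<tturnstile> isProp Q"
    using inh_transport[OF _ assms(2,1) inh_sym[OF _ assms], of "isProp v0"] that by (simp add: typing)
qed

text \<open>
  \<open>rosoliniStructure l Q\<close> lives in \<open>Univ (Suc l)\<close>, so choice principles for \<open>Univ l\<close> do not apply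
  to it. Proposition extensionality makes it logically equivalent to the following type in \<open>Univ l\<close>.
\<close>

definition smallRosolini :: "tm \<Rightarrow> tm" where
  "smallRosolini Q = Sg Ninf
     (isProp (wk Q) \<times>\<^sub>t (wk Q \<rightarrow>\<^sub>t extent (Fst v0)) \<times>\<^sub>t (extent (Fst v0) \<rightarrow>\<^sub>t wk Q))"

lemma smallRosolini_simps [simp]:
  "ren r (smallRosolini Q) = smallRosolini (ren r Q)"
  "subst s (smallRosolini Q) = smallRosolini (subst s Q)"
  "dest_Sg (smallRosolini Q) =
     Some (Ninf, isProp (wk Q) \<times>\<^sub>t (wk Q \<rightarrow>\<^sub>t extent (Fst v0)) \<times>\<^sub>t (extent (Fst v0) \<rightarrow>\<^sub>t wk Q))"
  by (simp_all add: smallRosolini_def)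

lemma wt_smallRosolini: "wt \<Gamma> Q (Univ l) \<Longrightarrow> wt \<Gamma> (smallRosolini Q) (Univ l)"
  by (simp add: smallRosolini_def typing)

text \<open>Proposition extensionality produces the path. It requires \<open>Q\<close> to be a
  proposition, which logical equivalence with an extent does not imply; hence
  \<open>smallRosolini\<close> records it.\<close>

lemma rosolini_of_small:
  assumes Q: "wt \<Gamma> Q (Univ l)"
  shows "\<Gamma> \<tturnstile> smallRosolini Q \<rightarrow>\<^sub>t rosoliniStructure l Q"
proof (rule inh_arr)
  let ?\<Delta> = "smallRosolini Q # \<Gamma>"
  show "ty \<Gamma> (smallRosolini Q)" using Q by (rule ty_wt[OF wt_smallRosolini])
  have "?\<Delta> \<tturnstile> Idt (Univ l) (wk Q) (extent (Fst (Fst v0)))"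
    using Q inh_nty[of ?\<Delta> "Fst (Snd v0)"] inh_nty[of ?\<Delta> "Fst (Snd (Snd v0))"]
      inh_nty[of ?\<Delta> "Snd (Snd (Snd v0))"] inh_nty[of ?\<Delta> "Snd (Fst v0)"]
    by (intro inh_Propext) (simp_all add: typing)
  then show "?\<Delta> \<tturnstile> wk (rosoliniStructure l Q)"
    using Q inh_Sg[of Ninf ?\<Delta> "Idt (Univ l) (wk (wk Q)) (extent (Fst v0))" "Fst v0"]
    by (simp add: typing flip: rosoliniStructure_def)
qed

lemma small_of_rosolini:
  assumes Q: "wt \<Gamma> Q (Univ l)"
  shows "\<Gamma> \<tturnstile> rosoliniStructure l Q \<rightarrow>\<^sub>t smallRosolini Q"
proof (rule inh_arr)
  let ?\<Delta> = "rosoliniStructure l Q # \<Gamma>"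
  let ?E = "extent (Fst (Fst v0))"
  show "ty \<Gamma> (rosoliniStructure l Q)" using Q by (simp add: typing)
  have eq: "?\<Delta> \<tturnstile> Idt (Univ l) (wk Q) ?E" by (rule inh_nty[of _ "Snd v0"]) (simp add: typing)
  have wt: "wt ?\<Delta> (wk Q) (Univ l)" "wt ?\<Delta> ?E (Univ l)" using Q by (simp_all add: typing)
  have "?\<Delta> \<tturnstile> isProp ?E" by (rule inh_nty[of _ "Snd (Fst v0)"]) (simp add: typing)
  then have "?\<Delta> \<tturnstile> isProp (wk Q) \<times>\<^sub>t (wk Q \<rightarrow>\<^sub>t ?E) \<times>\<^sub>t (?E \<rightarrow>\<^sub>t wk Q)"
    using inh_coe[OF wt eq] ty_wt[OF wt(1)] ty_wt[OF wt(2)] by (intro inh_times) (simp_all add: typing)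
  then show "?\<Delta> \<tturnstile> wk (smallRosolini Q)"
    using ty_wt[OF Q] inh_Sg[of Ninf ?\<Delta> "isProp (wk (wk Q)) \<times>\<^sub>t (wk (wk Q) \<rightarrow>\<^sub>t extent (Fst v0)) \<times>\<^sub>t
      (extent (Fst v0) \<rightarrow>\<^sub>t wk (wk Q))" "Fst v0"]
    by (simp add: typing flip: smallRosolini_def)
qed

text \<open>Apart from the binary sequence, every component of an element is a proof of a
  proposition. Pointwise agreement \<open>?R\<close> lies in \<open>Univ 0\<close> whatever
  \<open>l\<close> is.\<close>

lemma isSet_smallRosolini:
  assumes Q: "wt \<Gamma> Q (Univ l)"
  shows "\<Gamma> \<tturnstile> isSet (smallRosolini Q)"
proof -
  let ?S = "smallRosolini (wk (wk Q))"
  let ?B = "isProp (wk (wk (wk (wk Q)))) \<times>\<^sub>t (wk (wk (wk (wk Q))) \<rightarrow>\<^sub>t extent (Fst v0)) \<times>\<^sub>t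
    (extent (Fst v0) \<rightarrow>\<^sub>t wk (wk (wk (wk Q))))"
  let ?\<Delta> = "smallRosolini (wk Q) # smallRosolini Q # \<Gamma>"
  let ?R = "Pi Nat (Idt Two (App (Fst (Fst v2)) v0) (App (Fst (Fst v1)) v0))"
  have tyQ: "ty \<Gamma> Q" and tyS: "ty \<Gamma> (smallRosolini Q)"
    using Q wt_smallRosolini[OF Q] by (simp_all add: ty_wt)
  have R: "?\<Delta> \<tturnstile> isProp ?R"
  proof (rule isProp_Pi)
    show "Nat # ?\<Delta> \<tturnstile> isProp (Idt Two (App (Fst (Fst v2)) v0) (App (Fst (Fst v1)) v0))"
      by (rule isSetD[OF isSet_Two]) (simp_all add: typing)
  qed (simp_all add: typing)
  have to_R: "?\<Delta> \<tturnstile> Idt ?S v1 v0 \<rightarrow>\<^sub>t ?R"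
  proof (rule inh_arr)
    let ?\<Delta>' = "Nat # Idt ?S v1 v0 # ?\<Delta>"
    have "?\<Delta>' \<tturnstile> Idt Two (App (Fst (Fst v3)) v0) (App (Fst (Fst v2)) v0)"
      using inh_transport[of ?\<Delta>' "wk (wk ?S)" v3 v2 "Idt Two (App (Fst (Fst v4)) v1) (App (Fst (Fst v0)) v1)"]
        tyS inh_nty[of ?\<Delta>' v1] ty_wk[OF ty_wk[OF ty_wk[OF ty_wk[OF tyS]]]]
      by (simp add: typing inh_Refl)
    then show "Idt ?S v1 v0 # ?\<Delta> \<tturnstile> wk ?R"
      by (simp add: inh_Pi typing)
    show "ty ?\<Delta> (Idt ?S v1 v0)"
      using ty_wk[OF ty_wk[OF tyS]] by (simp add: typing)
  qed
  have of_R: "?\<Delta> \<tturnstile> ?R \<rightarrow>\<^sub>t Idt ?S v1 v0"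
  proof (rule inh_arr)
    let ?\<Delta>' = "?R # ?\<Delta>"
    show "ty ?\<Delta> ?R" by (simp add: typing)
    \<comment> \<open>Function extensionality identifies the sequences; the subtype principle lifts
      this path first to \<open>Ninf\<close> and then to the small structures.\<close>
    have "?\<Delta>' \<tturnstile> Idt Cantor (Fst (Fst v2)) (Fst (Fst v1))"
      using inh_Funext[of ?\<Delta>' Nat "Fst (Fst v2)" Two "Fst (Fst v1)"]
        inh_nty[of "Nat # ?\<Delta>'" "App v1 v0"] by (simp add: typing Cantor_def arr_def)
    then have N: "?\<Delta>' \<tturnstile> Idt Ninf (Fst v2) (Fst v1)"
      unfolding Ninf_def
      by (intro inh_Idt_Sg isProp_isProp[where i = 0]) (simp_all add: typing flip: Ninf_def)
    have Q': "ty (Ninf # ?\<Delta>') (wk (wk (wk (wk Q))))" "wt (Ninf # ?\<Delta>') (wk (wk (wk (wk Q)))) (Univ l)"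
      using Q tyQ by (simp_all add: typing)
    have B: "ty (Ninf # ?\<Delta>') ?B"
      using Q' by (simp add: typing)
    have "Ninf # ?\<Delta>' \<tturnstile> isProp ?B"
    \<comment> \<open>An assumed element of \<open>?B\<close> supplies that \<open>Q\<close> is a
      proposition, which makes the type of maps from the extent to \<open>Q\<close> one as
      well.\<close>
    proof (rule isProp_self[OF B])
      let ?\<Theta> = "?B # Ninf # ?\<Delta>'"
      have "?\<Theta> \<tturnstile> isProp (extent (Fst v1))" by (rule inh_nty[of _ "Snd v1"]) (simp add: typing)
      moreover have "?\<Theta> \<tturnstile> isProp (wk (wk (wk (wk (wk Q)))))"
        by (rule inh_nty[of _ "Fst v0"]) (simp add: typing)
      moreover have "wt ?\<Theta> (wk (wk (wk (wk (wk Q))))) (Univ l)"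
        "ty ?\<Theta> (wk (wk (wk (wk (wk Q)))))" using Q' by (simp_all add: typing)
      ultimately show "?\<Theta> \<tturnstile> isProp (wk ?B)"
        by (simp add: isProp_times isProp_arr isProp_isProp[of _ _ l] typing)
    qed
    then show "?\<Delta>' \<tturnstile> wk (Idt ?S v1 v0)"
      using N B inh_Idt_Sg[of ?\<Delta>' Ninf ?B v2 v1] by (simp add: typing smallRosolini_def)
  qed
  have "?\<Delta> \<tturnstile> propId 0 ?S v1 v0"
    using ty_wk[OF ty_wk[OF tyS]] R to_R of_R by (intro inh_propId[of _ ?R]) (simp_all add: typing)
  then show ?thesis
    using tyS ty_wk[OF tyS] by (intro isSet_of_propId inh_Pi) (simp_all add: typing)
qed

section \<open>The implications\<close>

lemma provable_iff_inh: "provable A \<longleftrightarrow> [] \<tturnstile> A"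
  by (simp add: provable_def inh_def ctx_nil)

text \<open>
  The hypotheses of Rosolini choice, with the truncation in \<open>isRosolini l P\<close> already eliminated:
  \<open>v5\<close> is the principle \<open>X\<close>, \<open>v4\<close> is \<open>P\<close> and \<open>v3\<close> is \<open>Q\<close>.
\<close>

definition rosoliniCtx :: "nat \<Rightarrow> tm \<Rightarrow> tm list" where
  "rosoliniCtx l X = [rosoliniStructure l v3, v2 \<rightarrow>\<^sub>t Trunc (rosoliniStructure l v1),
     Trunc (rosoliniStructure l v1), Univ l, Univ l, X]"

lemma provable_RosoliniChoice:
  assumes X: "ty [] X" and goal: "rosoliniCtx l X \<tturnstile> Trunc (v4 \<rightarrow>\<^sub>t rosoliniStructure l v3)"
  shows "provable (X \<rightarrow>\<^sub>t RosoliniChoice l)"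
proof -
  let ?\<Gamma> = "[v2 \<rightarrow>\<^sub>t Trunc (rosoliniStructure l v1), Trunc (rosoliniStructure l v1), Univ l, Univ l, X]"
  have "?\<Gamma> \<tturnstile> Trunc (v3 \<rightarrow>\<^sub>t rosoliniStructure l v2)"
    by (rule inh_TruncRec[of _ "rosoliniStructure l v3"])
      (use goal in \<open>simp_all add: typing rosoliniCtx_def inh_nty[of _ v1]\<close>)
  then show ?thesis using X
    by (simp add: provable_iff_inh RosoliniChoice_def Let_def isRosolini_def typing inh_arr inh_Pi)
qed

text \<open>Here \<open>Fst (Fst v0)\<close> is the sequence of the structure on \<open>P\<close>,
  and \<open>Snd v0\<close> is the path from \<open>P\<close> to its extent, along which everything
  about \<open>P\<close> is obtained. The last fact prepares the use of choice at the small
  type.\<close>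

lemma rosoliniCtx_facts:
  fixes l :: nat and X :: tm
  defines "\<Gamma> \<equiv> rosoliniCtx l X"
  shows "\<Gamma> \<tturnstile> v4 \<rightarrow>\<^sub>t extent (Fst (Fst v0))" "\<Gamma> \<tturnstile> extent (Fst (Fst v0)) \<rightarrow>\<^sub>t v4" "\<Gamma> \<tturnstile> isProp v4"
    "\<Gamma> \<tturnstile> v4 \<rightarrow>\<^sub>t Trunc (rosoliniStructure l v3)" "\<Gamma> \<tturnstile> v4 \<rightarrow>\<^sub>t Trunc (smallRosolini v3)"
proof -
  let ?E = "extent (Fst (Fst v0))"
  have \<Gamma>: "\<Gamma> = rosoliniCtx l X" by (simp add: \<Gamma>_def)
  note [simp] = typing \<Gamma> rosoliniCtx_def
  have wt: "wt \<Gamma> v4 (Univ l)" "wt \<Gamma> ?E (Univ l)" "wt \<Gamma> v3 (Univ l)" by simp_all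
  have eq: "\<Gamma> \<tturnstile> Idt (Univ l) v4 ?E" by (rule inh_nty[of _ "Snd v0"]) simp
  show "\<Gamma> \<tturnstile> v4 \<rightarrow>\<^sub>t ?E" "\<Gamma> \<tturnstile> ?E \<rightarrow>\<^sub>t v4" using inh_coe[OF wt(1,2) eq] by blast+
  have "\<Gamma> \<tturnstile> isProp ?E" by (rule inh_nty[of _ "Snd (Fst v0)"]) simp
  then show "\<Gamma> \<tturnstile> isProp v4" by (rule inh_coe(3)[OF wt(1,2) eq])
  show f: "\<Gamma> \<tturnstile> v4 \<rightarrow>\<^sub>t Trunc (rosoliniStructure l v3)" by (rule inh_nty[of _ v1]) simp
  have "\<Gamma> \<tturnstile> Trunc (rosoliniStructure l v3) \<rightarrow>\<^sub>t Trunc (smallRosolini v3)"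
    by (rule trunc_map_fun[OF _ ty_wt[OF wt_smallRosolini[OF wt(3)]] small_of_rosolini[OF wt(3)]]) simp
  then show "\<Gamma> \<tturnstile> v4 \<rightarrow>\<^sub>t Trunc (smallRosolini v3)"
    by (intro inh_compose[OF _ f]) simp_all
qed

lemma TruncatedWLPO_RosoliniChoice: "provable (TruncatedWLPO \<rightarrow>\<^sub>t RosoliniChoice l)"
proof (rule provable_RosoliniChoice)
  let ?\<Gamma> = "rosoliniCtx l TruncatedWLPO"
  let ?E = "extent (Fst (Fst v0))"
  let ?D = "Plus ?E (neg ?E)" and ?G = "v4 \<rightarrow>\<^sub>t rosoliniStructure l v3"
  have [simp]: "ren r TruncatedWLPO = TruncatedWLPO"
    "dest_Pi TruncatedWLPO = Some (Cantor, Trunc (Plus (extent v0) (neg (extent v0))))" for r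
    by (simp_all add: TruncatedWLPO_def Let_def)
  note [simp] = typing
  show "ty [] TruncatedWLPO" by (simp add: TruncatedWLPO_def Let_def)
  note facts = rosoliniCtx_facts[of l TruncatedWLPO]
  \<comment> \<open>Below the decision and its case hypothesis, \<open>P\<close> is
    \<open>v6\<close> and \<open>Q\<close> is \<open>v5\<close>.\<close>
  have "wk ?E # ?D # ?\<Gamma> \<tturnstile> v6 \<rightarrow>\<^sub>t Trunc (rosoliniStructure l v5)"
    using inh_wk[OF inh_wk[OF facts(4)]] by simp
  moreover have "wk ?E # ?D # ?\<Gamma> \<tturnstile> wk (wk ?E) \<rightarrow>\<^sub>t v6"
    using inh_wk[OF inh_wk[OF facts(2)]] by simp
  then have "wk ?E # ?D # ?\<Gamma> \<tturnstile> v6"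
    by (rule inh_mp) (simp add: inh_nty[of _ v0])
  ultimately have yes: "wk ?E # ?D # ?\<Gamma> \<tturnstile> wk (wk (Trunc ?G))"
    using trunc_arr_of_inh[of "wk ?E # ?D # ?\<Gamma>" v6 "rosoliniStructure l v5"] by (simp add: rosoliniCtx_def)
  have "neg (wk ?E) # ?D # ?\<Gamma> \<tturnstile> neg v6"
    unfolding neg_def
    by (rule inh_compose[of _ _ "wk (wk ?E)"])
      (use inh_wk[OF inh_wk[OF facts(1)]] in \<open>simp_all add: inh_nty[of _ v0] neg_def rosoliniCtx_def\<close>)
  then have no: "neg (wk ?E) # ?D # ?\<Gamma> \<tturnstile> wk (wk (Trunc ?G))"
    using trunc_arr_of_neg[of "neg (wk ?E) # ?D # ?\<Gamma>" v6 "rosoliniStructure l v5"]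
    by (simp add: rosoliniCtx_def)
  have D: "?D # ?\<Gamma> \<tturnstile> wk (Trunc ?G)"
    by (rule inh_Case[OF _ _ _ _ yes no]) (simp_all add: inh_nty[of _ v0] rosoliniCtx_def)
  show "?\<Gamma> \<tturnstile> Trunc ?G"
    by (rule inh_TruncRec[OF _ _ _ D])
      (simp_all add: inh_nty[of _ "App v5 (Fst (Fst v0))"] rosoliniCtx_def)
qed

lemma WLPO_TruncatedWLPO: "[] \<tturnstile> WLPO \<rightarrow>\<^sub>t TruncatedWLPO"
proof -
  have [simp]: "ren r TruncatedWLPO = TruncatedWLPO" "ren r WLPO = WLPO"
    "dest_Pi WLPO = Some (Cantor, Plus (extent v0) (neg (extent v0)))" for r
    by (simp_all add: TruncatedWLPO_def WLPO_def Let_def)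
  have "ty [] WLPO" by (simp add: WLPO_def Let_def typing)
  moreover have "[Cantor, WLPO] \<tturnstile> Trunc (Plus (extent v0) (neg (extent v0)))"
    by (rule inh_Trunc, rule inh_nty[of _ "App v1 v0"]) (simp add: typing)
  ultimately show ?thesis
    by (intro inh_arr) (simp_all add: TruncatedWLPO_def Let_def inh_Pi typing)
qed

text \<open>Only the second alternative needs work: if the sequence is constantly zero, an element
  of its extent transports to an identification of \<open>Zero2\<close> with
  \<open>One2\<close>.\<close>

lemma LPO_WLPO: "[] \<tturnstile> LPO \<rightarrow>\<^sub>t WLPO"
proof -
  let ?Z = "Lam Nat Zero2" and ?E = "extent v0"
  let ?D = "Plus ?E (Idt Cantor v0 ?Z)"
  let ?\<Gamma> = "[Cantor, LPO]"
  let ?\<Delta> = "extent v2 # Idt Cantor v1 ?Z # ?D # ?\<Gamma>"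
  have Z: "wt \<Gamma> ?Z Cantor" for \<Gamma>
    using wt_Lam[of \<Gamma> Nat Zero2 Two] by (simp add: typing Cantor_def arr_def)
  note [simp] = typing Z
  have [simp]: "ren r LPO = LPO" "dest_Pi LPO = Some (Cantor, ?D)" for r
    by (simp_all add: LPO_def Let_def)
  have LPO: "ty [] LPO" by (simp add: LPO_def Let_def)
  have "?\<Delta> \<tturnstile> Idt Two (App ?Z (Fst v0)) One2"
  proof -
    have "wt (Cantor # ?\<Delta>) (App v0 (Fst v1)) Two" by simp
    then show ?thesis
    using inh_transport[of ?\<Delta> Cantor v3 ?Z "Idt Two (App v0 (Fst v1)) One2"]
      inh_nty[of ?\<Delta> "Snd v0"] inh_nty[of ?\<Delta> v1] by (simp add: holds_at_def)
  qed
  \<comment> \<open>Transport leaves the constant sequence applied to the index; a beta step is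
    needed before bits can be compared.\<close>
  moreover have "?\<Delta> \<turnstile> Idt Two (App ?Z (Fst v0)) One2 \<^bold>\<equiv> Idt Two Zero2 One2 \<^bold>: Univ 0" if "\<turnstile> ?\<Delta>"
  proof (rule eq_Idt)
    have "\<turnstile> Nat # ?\<Delta>" by (rule ctx_Cons[OF _ that]) simp
    then have "Nat # ?\<Delta> \<turnstile> Zero2 \<^bold>: Two" by (rule ty_Zero2)
    from Pi_beta[OF this nty_sound[OF that, of "Fst v0"]]
    show "?\<Delta> \<turnstile> App ?Z (Fst v0) \<^bold>\<equiv> Zero2 \<^bold>: Two" by simp
  qed (use that in \<open>auto intro: eq_refl ty_Two ty_One2\<close>)
  ultimately have "?\<Delta> \<tturnstile> Idt Two Zero2 One2" by (rule inh_convert)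
  then have "?\<Delta> \<tturnstile> Empty"
    using Zero2_neq_One2 unfolding neg_def by (blast intro: inh_mp)
  then have "Idt Cantor v1 ?Z # ?D # ?\<Gamma> \<tturnstile> neg (extent v2)"
    unfolding neg_def by (intro inh_arr) simp_all
  then have no: "wk (Idt Cantor v0 ?Z) # ?D # ?\<Gamma> \<tturnstile> wk (wk (Plus ?E (neg ?E)))"
    by (simp add: inh_Plus(2))
  have yes: "wk ?E # ?D # ?\<Gamma> \<tturnstile> wk (wk (Plus ?E (neg ?E)))"
    by (simp add: inh_Plus(1) inh_nty[of _ v0])
  have "?D # ?\<Gamma> \<tturnstile> wk (Plus ?E (neg ?E))"
    by (rule inh_Case[OF _ _ _ _ yes no]) (simp_all add: inh_nty[of _ v0])
  moreover have "?\<Gamma> \<tturnstile> ?D" by (rule inh_nty[of _ "App v1 v0"]) simp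
  ultimately have "?\<Gamma> \<tturnstile> Plus ?E (neg ?E)" by - (rule inh_cut[of _ ?D]; simp)
  then show ?thesis using LPO
    by (intro inh_arr) (simp_all add: WLPO_def Let_def inh_Pi)
qed

text \<open>For a single bit no choice is involved: its being \<open>One2\<close> is refuted for
  \<open>Zero2\<close>, and for \<open>One2\<close> the map can be evaluated at reflexivity.\<close>

lemma trunc_decidable:
  assumes S: "ty \<Gamma> S" and t: "wt \<Gamma> t Two" and f: "\<Gamma> \<tturnstile> Idt Two t One2 \<rightarrow>\<^sub>t Trunc S"
  shows "\<Gamma> \<tturnstile> Trunc (Idt Two t One2 \<rightarrow>\<^sub>t S)"
proof -
  \<comment> \<open>The type of the given map mentions \<open>t\<close>, so the map is abstracted in
    the motive and supplied after the induction.\<close>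
  let ?C = "(Idt Two v0 One2 \<rightarrow>\<^sub>t Trunc (wk S)) \<rightarrow>\<^sub>t Trunc (Idt Two v0 One2 \<rightarrow>\<^sub>t wk S)"
  have "\<Gamma> \<tturnstile> inst ?C t"
  proof (rule inh_TwoInd[OF _ _ _ t])
    show "ty (Two # \<Gamma>) ?C" using S by (simp add: typing)
    show "\<Gamma> \<tturnstile> inst ?C Zero2"
      using S by (simp add: typing inh_arr trunc_arr_of_neg Zero2_neq_One2)
    show "\<Gamma> \<tturnstile> inst ?C One2"
      using S by (simp add: typing inh_arr trunc_arr_of_inh inh_Refl inh_nty[of _ v0])
  qed
  then show ?thesis using inh_mp[OF _ f] by (simp add: inst_def)
qed

lemma SemidecidableChoice_RosoliniChoice: "provable (SemidecidableChoice l \<rightarrow>\<^sub>t RosoliniChoice l)"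
proof (rule provable_RosoliniChoice)
  let ?X = "SemidecidableChoice l"
  let ?\<Gamma> = "rosoliniCtx l ?X"
  let ?\<alpha> = "Fst (Fst v0)" and ?S = "smallRosolini v3"
  let ?H = "holds_at (Fst (Fst v1)) v0"
  let ?F = "Pi Nat (?H \<rightarrow>\<^sub>t smallRosolini v4)"
  have SC: "?X = Pi (Univ l) (Pi Cantor (Pi Nat (Trunc (holds_at v1 v0 \<rightarrow>\<^sub>t v2)) \<rightarrow>\<^sub>t
      Trunc (Pi Nat (holds_at v1 v0 \<rightarrow>\<^sub>t v2))))"
    by (simp add: SemidecidableChoice_def Let_def numeral_2_eq_2)
  have [simp]: "ren r ?X = ?X" for r by (simp add: SC)
  note [simp] = typing rosoliniCtx_def
  note facts = rosoliniCtx_facts[of l ?X]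
  have small: "wt \<Delta> (smallRosolini Q) (Univ l)" "ty \<Delta> (smallRosolini Q)"
    if "nty \<Delta> Q = Some (Univ l)" for \<Delta> Q
    using that by (simp_all add: wt_smallRosolini ty_wt[OF wt_smallRosolini[of _ _ l]])
  show "ty [] ?X" by (simp add: SC)
  have "?\<Gamma> \<tturnstile> ?X" by (rule inh_nty[of _ v5]) simp
  then have "?\<Gamma> \<tturnstile> Pi (Univ l) (Pi Cantor (Pi Nat (Trunc (holds_at v1 v0 \<rightarrow>\<^sub>t v2)) \<rightarrow>\<^sub>t
      Trunc (Pi Nat (holds_at v1 v0 \<rightarrow>\<^sub>t v2))))" by (rule SC[THEN subst])
  from inh_App[OF this, of ?S]
  have "?\<Gamma> \<tturnstile> Pi Cantor (Pi Nat (Trunc (holds_at v1 v0 \<rightarrow>\<^sub>t smallRosolini v5)) \<rightarrow>\<^sub>t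
      Trunc (Pi Nat (holds_at v1 v0 \<rightarrow>\<^sub>t smallRosolini v5)))"
    by (simp add: small)
  from inh_App[OF this, of ?\<alpha>]
  have SC': "?\<Gamma> \<tturnstile> Pi Nat (Trunc (?H \<rightarrow>\<^sub>t smallRosolini v4)) \<rightarrow>\<^sub>t Trunc ?F" by simp
  \<comment> \<open>An index at which the sequence is one gives an element of the extent, hence of
    \<open>P\<close>, so the hypothesis of Rosolini choice applies.\<close>
  have "?H # Nat # ?\<Gamma> \<tturnstile> extent (Fst (Fst v2))"
    unfolding extent_def by (rule inh_Sg[of _ _ _ v1]) (simp_all add: inh_nty[of _ v0])
  moreover have "?H # Nat # ?\<Gamma> \<tturnstile> extent (Fst (Fst v2)) \<rightarrow>\<^sub>t v6"
    "?H # Nat # ?\<Gamma> \<tturnstile> v6 \<rightarrow>\<^sub>t Trunc (smallRosolini v5)"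
    using inh_wk[OF inh_wk[OF facts(2)]] inh_wk[OF inh_wk[OF facts(5)]] by simp_all
  ultimately have "?H # Nat # ?\<Gamma> \<tturnstile> Trunc (smallRosolini v5)"
    by (blast intro: inh_mp)
  then have "Nat # ?\<Gamma> \<tturnstile> ?H \<rightarrow>\<^sub>t Trunc (smallRosolini v4)"
    by (intro inh_arr) simp_all
  then have "Nat # ?\<Gamma> \<tturnstile> Trunc (?H \<rightarrow>\<^sub>t smallRosolini v4)"
    unfolding holds_at_def by (intro trunc_decidable) (simp_all add: small)
  then have F: "?\<Gamma> \<tturnstile> Trunc ?F"
    by (intro inh_mp[OF SC'] inh_Pi) simp_all
  let ?\<Delta> = "v5 # ?F # ?\<Gamma>"
  have "extent (Fst (Fst v2)) # ?\<Delta> \<tturnstile> smallRosolini v6"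
    by (rule inh_nty[of _ "App (App v2 (Fst v0)) (Snd v0)"]) simp
  moreover have "?\<Delta> \<tturnstile> v6 \<rightarrow>\<^sub>t extent (Fst (Fst v2))"
    using inh_wk[OF inh_wk[OF facts(1)]] by simp
  then have "?\<Delta> \<tturnstile> extent (Fst (Fst v2))"
    by (rule inh_mp) (simp add: inh_nty[of _ v0])
  ultimately have "?\<Delta> \<tturnstile> smallRosolini v5"
    by - (rule inh_cut[of _ "extent (Fst (Fst v2))"]; simp)
  with rosolini_of_small[of ?\<Delta> v5 l] have "?\<Delta> \<tturnstile> rosoliniStructure l v5"
    by (simp add: inh_mp)
  then have "?\<Gamma> \<tturnstile> ?F \<rightarrow>\<^sub>t (v4 \<rightarrow>\<^sub>t rosoliniStructure l v3)"
    by (intro inh_arr) (simp_all add: inh_arr small)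
  with F show "?\<Gamma> \<tturnstile> Trunc (v4 \<rightarrow>\<^sub>t rosoliniStructure l v3)"
    by - (rule trunc_map[of _ ?F]; simp add: small)
qed

lemma CountableChoice_SemidecidableChoice: "[] \<tturnstile> CountableChoice l \<rightarrow>\<^sub>t SemidecidableChoice l"
proof -
  let ?X = "CountableChoice l"
  let ?H = "Pi Nat (Trunc (holds_at v1 v0 \<rightarrow>\<^sub>t v2))"
  let ?\<Delta> = "[?H, Cantor, Univ l, ?X]"
  let ?y = "holds_at v2 v0 \<rightarrow>\<^sub>t v3"
  let ?Y = "Lam Nat ?y"
  have CC: "?X = Pi (Nat \<rightarrow>\<^sub>t Univ l) (Pi Nat (Trunc (App v1 v0)) \<rightarrow>\<^sub>t Trunc (Pi Nat (App v1 v0)))"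
    by (simp add: CountableChoice_def Let_def)
  have SC: "SemidecidableChoice l = Pi (Univ l) (Pi Cantor (?H \<rightarrow>\<^sub>t
      Trunc (Pi Nat (holds_at v1 v0 \<rightarrow>\<^sub>t v2))))"
    by (simp add: SemidecidableChoice_def Let_def numeral_2_eq_2)
  note [simp] = typing
  have [simp]: "ren r ?X = ?X" for r by (simp add: CC)
  have tyX: "ty [] ?X" by (simp add: CC)
  have ctx: "\<turnstile> ?\<Delta>" "\<turnstile> Nat # ?\<Delta>"
    by (auto intro!: ctx_Cons ctx_nil tyX)
  have "wt (Nat # ?\<Delta>) ?y (Univ l)" by simp
  with ctx(2) have y: "Nat # ?\<Delta> \<turnstile> ?y \<^bold>: Univ l" by (simp add: wt_def)
  have Y: "wt ?\<Delta> ?Y (Nat \<rightarrow>\<^sub>t Univ l)"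
    using ty_Lam[OF y] by (simp add: wt_def arr_def)
  \<comment> \<open>Instantiating the principle at \<open>?Y\<close> leaves beta redexes below the
    products and truncations; they are removed by congruence in both directions.\<close>
  have "Nat # ?\<Delta> \<turnstile> App (wk ?Y) v0 \<^bold>\<equiv> ?y \<^bold>: Univ l"
  proof -
    have "wt (Nat # Nat # ?\<Delta>) (holds_at v3 v0 \<rightarrow>\<^sub>t v4) (Univ l)" by simp
    moreover have "\<turnstile> Nat # Nat # ?\<Delta>" by (rule ctx_Cons[OF _ ctx(2)]) simp
    ultimately have "Nat # Nat # ?\<Delta> \<turnstile> holds_at v3 v0 \<rightarrow>\<^sub>t v4 \<^bold>: Univ l" by (simp add: wt_def)
    from Pi_beta[OF this nty_sound[OF ctx(2), of v0]] show ?thesis by simp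
  qed
  then have conv: "?\<Delta> \<turnstile> Pi Nat (Trunc ?y) \<^bold>\<equiv> Pi Nat (Trunc (App (wk ?Y) v0)) \<^bold>: Univ l"
    "?\<Delta> \<turnstile> Trunc (Pi Nat (App (wk ?Y) v0)) \<^bold>\<equiv> Trunc (Pi Nat ?y) \<^bold>: Univ l"
    using ctx by (auto intro!: eq_Pi eq_Trunc eq_refl ty_Nat intro: eq_sym)
  have "?\<Delta> \<tturnstile> ?X" by (rule inh_nty[of _ v3]) simp
  then have "?\<Delta> \<tturnstile> Pi (Nat \<rightarrow>\<^sub>t Univ l) (Pi Nat (Trunc (App v1 v0)) \<rightarrow>\<^sub>t Trunc (Pi Nat (App v1 v0)))"
    by (rule CC[THEN subst])
  from inh_App[OF this Y]
  have "?\<Delta> \<tturnstile> Pi Nat (Trunc (App (wk ?Y) v0)) \<rightarrow>\<^sub>t Trunc (Pi Nat (App (wk ?Y) v0))" by simp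
  moreover have "?\<Delta> \<tturnstile> Pi Nat (Trunc ?y)" by (rule inh_nty[of _ v0]) simp
  then have "?\<Delta> \<tturnstile> Pi Nat (Trunc (App (wk ?Y) v0))" by (rule inh_convert) (rule conv)
  ultimately have "?\<Delta> \<tturnstile> Trunc (Pi Nat (App (wk ?Y) v0))" by (rule inh_mp)
  then have "?\<Delta> \<tturnstile> Trunc (Pi Nat ?y)" by (rule inh_convert) (rule conv)
  then show ?thesis using tyX by (simp add: SC inh_arr inh_Pi)
qed

lemma PropositionalChoice_RosoliniChoice: "provable (PropositionalChoice l \<rightarrow>\<^sub>t RosoliniChoice l)"
proof (rule provable_RosoliniChoice)
  let ?X = "PropositionalChoice l"
  let ?\<Gamma> = "rosoliniCtx l ?X"
  let ?S = "smallRosolini v3"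
  have PC: "?X = Pi (Univ l) (Pi (Univ l) (isSet v0 \<rightarrow>\<^sub>t isProp v1 \<rightarrow>\<^sub>t (v1 \<rightarrow>\<^sub>t Trunc v0) \<rightarrow>\<^sub>t Trunc (v1 \<rightarrow>\<^sub>t v0)))"
    by (simp add: PropositionalChoice_def Let_def)
  note [simp] = typing rosoliniCtx_def
  have [simp]: "ren r ?X = ?X" for r by (simp add: PC)
  show "ty [] ?X" by (simp add: PC)
  note facts = rosoliniCtx_facts[of l ?X]
  have Q: "wt ?\<Gamma> v3 (Univ l)" by simp
  note S = wt_smallRosolini[OF Q]
  have "?\<Gamma> \<tturnstile> ?X" by (rule inh_nty[of _ v5]) simp
  then have "?\<Gamma> \<tturnstile> Pi (Univ l) (Pi (Univ l)
      (isSet v0 \<rightarrow>\<^sub>t isProp v1 \<rightarrow>\<^sub>t (v1 \<rightarrow>\<^sub>t Trunc v0) \<rightarrow>\<^sub>t Trunc (v1 \<rightarrow>\<^sub>t v0)))"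
    by (rule PC[THEN subst])
  from inh_App[OF this, of v4]
  have "?\<Gamma> \<tturnstile> Pi (Univ l) (isSet v0 \<rightarrow>\<^sub>t isProp v5 \<rightarrow>\<^sub>t (v5 \<rightarrow>\<^sub>t Trunc v0) \<rightarrow>\<^sub>t Trunc (v5 \<rightarrow>\<^sub>t v0))" by simp
  from inh_App[OF this S]
  have "?\<Gamma> \<tturnstile> isSet ?S \<rightarrow>\<^sub>t isProp v4 \<rightarrow>\<^sub>t (v4 \<rightarrow>\<^sub>t Trunc ?S) \<rightarrow>\<^sub>t Trunc (v4 \<rightarrow>\<^sub>t ?S)" by simp
  from inh_mp[OF inh_mp[OF inh_mp[OF this isSet_smallRosolini[OF Q]] facts(3)] facts(5)]
  have F: "?\<Gamma> \<tturnstile> Trunc (v4 \<rightarrow>\<^sub>t ?S)" .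
  let ?\<Delta> = "(v4 \<rightarrow>\<^sub>t ?S) # ?\<Gamma>"
  have "?\<Delta> \<tturnstile> v5 \<rightarrow>\<^sub>t smallRosolini v4" by (rule inh_nty[of _ v0]) simp
  then have "?\<Delta> \<tturnstile> v5 \<rightarrow>\<^sub>t rosoliniStructure l v4"
    by (rule inh_compose[rotated]) (simp_all add: rosolini_of_small)
  then have "?\<Gamma> \<tturnstile> (v4 \<rightarrow>\<^sub>t ?S) \<rightarrow>\<^sub>t (v4 \<rightarrow>\<^sub>t rosoliniStructure l v3)"
    using ty_wt[OF S] by (intro inh_arr) simp_all
  with F show "?\<Gamma> \<tturnstile> Trunc (v4 \<rightarrow>\<^sub>t rosoliniStructure l v3)"
    using ty_wt[OF S] by - (rule trunc_map[of _ "v4 \<rightarrow>\<^sub>t ?S"]; simp)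
qed

theorem theorem5p33:
  fixes l :: nat
  shows "provable (CountableChoice l \<rightarrow>\<^sub>t RosoliniChoice l)
       \<and> provable (SemidecidableChoice l \<rightarrow>\<^sub>t RosoliniChoice l)
       \<and> provable (LPO \<rightarrow>\<^sub>t RosoliniChoice l)
       \<and> provable (WLPO \<rightarrow>\<^sub>t RosoliniChoice l)
       \<and> provable (TruncatedWLPO \<rightarrow>\<^sub>t RosoliniChoice l)
       \<and> provable (PropositionalChoice l \<rightarrow>\<^sub>t RosoliniChoice l)"
proof -
  have Z: "wt \<Gamma> (Lam Nat Zero2) Cantor" for \<Gamma>
    using wt_Lam[of \<Gamma> Nat Zero2 Two] by (simp add: typing Cantor_def arr_def)
  have ty: "ty [] (CountableChoice l)" "ty [] LPO" "ty [] WLPO"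
    by (simp_all add: CountableChoice_def LPO_def WLPO_def Let_def typing Z)
  note T = TruncatedWLPO_RosoliniChoice[of l] and S = SemidecidableChoice_RosoliniChoice[of l]
  note W = inh_compose[OF ty(3) WLPO_TruncatedWLPO T[unfolded provable_iff_inh]]
  note L = inh_compose[OF ty(2) LPO_WLPO W]
  note C = inh_compose[OF ty(1) CountableChoice_SemidecidableChoice S[unfolded provable_iff_inh]]
  show ?thesis
    using S T W L C PropositionalChoice_RosoliniChoice by (simp add: provable_iff_inh)
qed

end
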